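(* Let $\ell,m,n\ge 1$ be integers. For $1\le j\le m$ let $$\mathcal{L}_j:=\mathcal{L}_j(z_1,\ldots,z_\ell)=\sum_{k=1}^{\ell}A_{jk}z_k+B_j,$$ where $A_{jk}$, $1\le k\le\ell$, are positive semidefinite (complex Hermitian) $n\times n$ matrices and $B_j$ is a Hermitian $n\times n$ matrix. Then $$\eta(\mathcal{L}_1,\ldots,\mathcal{L}_m)\in\mathcal{H}_\ell(\mathbb{R})\cup\{0\}.$$ Moreover, if $v$ is a new variable, then $$\eta(\mathcal{L}_1,\ldots,\mathcal{L}_m)+v\,\eta\big(\mathcal{L}_1[\{j\}'],\ldots,\mathcal{L}_m[\{j\}']\big)\in\mathcal{H}_{\ell+1}(\mathbb{R})\cup\{0\},\qquad 1\le j\le n,$$ as a polynomial in the variables $z_1,\ldots,z_\ell,v$.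
   Context: For an $n\times n$ matrix $A$ and $\mathcal{S}\subseteq\{1,\ldots,n\}$, $A[\mathcal{S}]$ denotes the principal submatrix of $A$ with rows and columns indexed by $\mathcal{S}$, $\mathcal{S}'$ denotes the complement of $\mathcal{S}$ in $\{1,\ldots,n\}$, and by convention $\det(A[\emptyset])=1$. The mixed determinant of an $m$-tuple $(A_1,\ldots,A_m)$ of $n\times n$ matrices is $$\eta(A_1,\ldots,A_m)=\sum_{(\mathcal{S}_1,\ldots,\mathcal{S}_m)}\det(A_1[\mathcal{S}_1])\cdots\det(A_m[\mathcal{S}_m]),$$ where the sum is over all $m$-tuples $(\mathcal{S}_1,\ldots,\mathcal{S}_m)$ of pairwise disjoint (possibly empty) subsets of $\{1,\ldots,n\}$ with $\mathcal{S}_1\cup\cdots\cup\mathcal{S}_m=\{1,\ldots,n\}$. (For $0\times0$ matrices, $\eta=1$.) A polynomial $f\in\mathbb{C}[z_1,\ldots,z_n]$ is stable if $f(z_1,\ldots,z_n)\ne 0$ for all $(z_1,\ldots,z_n)\in\mathbb{C}^n$ with $\operatorname{Im}(z_j)>0$ for $1\le j\le n$; it is real stable if in addition it has real coefficients. $\mathcal{H}_n(\mathbb{R})$ denotes the set of real stable polynomials in $n$ variables. *)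

theory Defs
  imports
    Complex_Main
    "HOL-Library.FuncSet"
    "HOL-Library.Disjoint_Sets"
    "HOL-Library.Poly_Mapping"
    "Jordan_Normal_Form.Determinant"
    "Jordan_Normal_Form.DL_Submatrix"
    "Jordan_Normal_Form.Schur_Decomposition"
begin

text \<open>
  All index sets are zero-based, as in the matrix library: rows and columns of an
  \<open>n \<times> n\<close> matrix are indexed by \<open>{..<n}\<close>, an \<open>m\<close>-tuple by \<open>{..<m}\<close>, and the variables
  \<open>z\<^sub>1, \<dots>, z\<^sub>l\<close> are the variables with numbers \<open>0, \<dots>, l - 1\<close>.
\<close>

section \<open>Multivariate polynomials\<close>

text \<open>
  Polynomials are finitely supported maps from exponent vectors to coefficients; the ring
  structure is the convolution product of \<^theory>\<open>HOL-Library.Poly_Mapping\<close>.  The type has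
  countably many variables; \<open>polys n\<close> is the polynomial ring in the first \<open>n\<close> of them.
\<close>

type_synonym 'a mpoly = "(nat \<Rightarrow>\<^sub>0 nat) \<Rightarrow>\<^sub>0 'a"

definition mconst :: "'a::zero \<Rightarrow> 'a mpoly" where
  "mconst c = Poly_Mapping.single 0 c"

definition mvar :: "nat \<Rightarrow> 'a::{zero,one} mpoly" where
  "mvar i = Poly_Mapping.single (Poly_Mapping.single i 1) 1"

definition mcoeff :: "'a::zero mpoly \<Rightarrow> (nat \<Rightarrow>\<^sub>0 nat) \<Rightarrow> 'a" where
  "mcoeff f e = Poly_Mapping.lookup f e"

definition meval :: "'a::comm_semiring_1 mpoly \<Rightarrow> (nat \<Rightarrow> 'a) \<Rightarrow> 'a" where
  "meval f z = (\<Sum>e \<in> Poly_Mapping.keys f.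
     mcoeff f e * (\<Prod>i \<in> Poly_Mapping.keys e. z i ^ Poly_Mapping.lookup e i))"

definition polys :: "nat \<Rightarrow> 'a::zero mpoly set" where
  "polys n = {f. \<forall>e \<in> Poly_Mapping.keys f. Poly_Mapping.keys e \<subseteq> {..<n}}"


section \<open>Real stable polynomials\<close>

text \<open>
  A point of \<open>\<complex>\<^sup>n\<close> is given by the first \<open>n\<close> values of \<open>z\<close>; the remaining values
  do not affect the evaluation of an element of \<open>polys n\<close>.
\<close>

definition stable :: "nat \<Rightarrow> complex mpoly \<Rightarrow> bool" where
  "stable n f \<longleftrightarrow> f \<in> polys n \<and>
     (\<forall>z. (\<forall>j<n. Im (z j) > 0) \<longrightarrow> meval f z \<noteq> 0)"

definition real_stable_polys :: "nat \<Rightarrow> complex mpoly set" where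
  "real_stable_polys n = {f. stable n f \<and> (\<forall>e. mcoeff f e \<in> \<real>)}"


section \<open>Hermitian and positive semidefinite matrices\<close>

definition hermitian_mat :: "complex mat \<Rightarrow> bool" where
  "hermitian_mat A \<longleftrightarrow> mat_adjoint A = A"

definition psd_mat :: "complex mat \<Rightarrow> bool" where
  "psd_mat A \<longleftrightarrow> hermitian_mat A \<and>
     (\<forall>x \<in> carrier_vec (dim_row A). Re ((A *\<^sub>v x) \<bullet>c x) \<ge> 0)"


section \<open>Mixed determinants\<close>

definition principal_submatrix :: "'a mat \<Rightarrow> nat set \<Rightarrow> 'a mat" where
  "principal_submatrix A S = submatrix A S S"

text \<open>
  Mixed determinant of the \<open>m\<close>-tuple \<open>A 0, \<dots>, A (m - 1)\<close> of \<open>n \<times> n\<close> matrices.  The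
  \<open>m\<close>-tuples of sets are extensional functions, so each tuple is counted once; the
  library determinant of a \<open>0 \<times> 0\<close> matrix is \<open>1\<close>.
\<close>

definition mixed_det :: "nat \<Rightarrow> nat \<Rightarrow> (nat \<Rightarrow> 'a mat) \<Rightarrow> 'a::comm_ring_1" where
  "mixed_det n m A =
     (\<Sum>S \<in> {S \<in> {..<m} \<rightarrow>\<^sub>E Pow {..<n}.
              disjoint_family_on S {..<m} \<and> (\<Union>i<m. S i) = {..<n}}.
        \<Prod>i<m. det (principal_submatrix (A i) (S i)))"

text \<open>
  The matrix \<open>A\<^sub>0 z\<^sub>0 + \<dots> + A\<^sub>l\<^sub>-\<^sub>1 z\<^sub>l\<^sub>-\<^sub>1 + B\<close> with polynomial entries.
\<close>

definition linear_pencil ::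
    "nat \<Rightarrow> nat \<Rightarrow> (nat \<Rightarrow> complex mat) \<Rightarrow> complex mat \<Rightarrow> complex mpoly mat" where
  "linear_pencil n l A B = Matrix.mat n n
     (\<lambda>(a, b). (\<Sum>k<l. mconst (A k $$ (a, b)) * mvar k) + mconst (B $$ (a, b)))"

end

theory Submission
  imports "HOL-Complex_Analysis.Great_Picard" Defs
begin

text \<open>
  If \<open>C\<^sub>1, \<dots>, C\<^sub>m\<close> have positive definite imaginary parts, then \<open>\<Prod>j. det (C\<^sub>j + diag x)\<close> does not
  vanish for \<open>Im x\<^sub>i \<ge> 0\<close>, and the mixed determinant is its coefficient of \<open>\<Prod>i. x\<^sub>i ^ (m - 1)\<close>.  The
  variables are eliminated one at a time: a polynomial of degree \<open>m\<close> in one variable with all roots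
  in the open lower half plane has a nonzero coefficient of degree \<open>m - 1\<close>, since its roots have a
  nonzero sum.  The leading coefficient, which has to be nonzero as well, is an expression of the
  same kind for a smaller principal submatrix.  Semidefinite coefficients follow by perturbation and
  Hurwitz' theorem.  Appending the matrix \<open>v E\<^sub>j\<^sub>j\<close> to the tuple adds
  \<open>v \<eta>(\<L>\<^sub>1[{j}'], \<dots>, \<L>\<^sub>m[{j}'])\<close> to the mixed determinant, so the second claim is an instance of
  the first.
\<close>

section \<open>Evaluation of multivariate polynomials\<close>

text \<open>Monomials may cancel in a sum, so the keys of \<open>f + g\<close> are only contained in
  the union of the keys; evaluations are therefore compared over a common finite index set.\<close>

lemma meval_superset:
  assumes "finite E" "Poly_Mapping.keys f \<subseteq> E"
  shows "meval f z = (\<Sum>e\<in>E. mcoeff f e * (\<Prod>i \<in> Poly_Mapping.keys e. z i ^ Poly_Mapping.lookup e i))"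
  unfolding meval_def mcoeff_def
  by (rule sum.mono_neutral_left) (use assms in \<open>auto simp: in_keys_iff\<close>)

lemma meval_add: "meval (f + g) z = meval f z + meval g z"
proof -
  let ?E = "Poly_Mapping.keys f \<union> Poly_Mapping.keys g"
  have "Poly_Mapping.keys (f + g) \<subseteq> ?E" by (rule Poly_Mapping.keys_add)
  then show ?thesis
    by (simp add: meval_superset[of ?E] mcoeff_def lookup_add distrib_right sum.distrib)
qed

lemma meval_zero [simp]: "meval 0 z = 0"
  by (simp add: meval_def)

lemma meval_sum: "meval (sum f I) z = (\<Sum>i\<in>I. meval (f i) z)"
  by (induction I rule: infinite_finite_induct) (simp_all add: meval_add)

lemma monomial_value_superset:
  fixes z :: "nat \<Rightarrow> 'a::comm_semiring_1"
  assumes "finite I" "Poly_Mapping.keys e \<subseteq> I"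
  shows "(\<Prod>i\<in>Poly_Mapping.keys e. z i ^ Poly_Mapping.lookup e i) = (\<Prod>i\<in>I. z i ^ Poly_Mapping.lookup e i)"
  by (rule prod.mono_neutral_left) (use assms in \<open>auto simp: in_keys_iff\<close>)

lemma monomial_value_add:
  fixes z :: "nat \<Rightarrow> 'a::comm_semiring_1" and e e' :: "nat \<Rightarrow>\<^sub>0 nat"
  shows "(\<Prod>i\<in>Poly_Mapping.keys (e + e'). z i ^ Poly_Mapping.lookup (e + e') i) =
    (\<Prod>i\<in>Poly_Mapping.keys e. z i ^ Poly_Mapping.lookup e i) *
    (\<Prod>i\<in>Poly_Mapping.keys e'. z i ^ Poly_Mapping.lookup e' i)"
proof -
  let ?I = "Poly_Mapping.keys e \<union> Poly_Mapping.keys e'"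
  have "Poly_Mapping.keys (e + e') \<subseteq> ?I" by (rule Poly_Mapping.keys_add)
  then show ?thesis
    by (subst (1 2 3) monomial_value_superset[of ?I])
      (simp_all add: lookup_add power_add prod.distrib)
qed

lemma meval_single:
  "meval (Poly_Mapping.single e c) z = c * (\<Prod>i\<in>Poly_Mapping.keys e. z i ^ Poly_Mapping.lookup e i)"
  by (cases "c = 0") (simp_all add: meval_def mcoeff_def)

lemma mpoly_eq_sum_monomials:
  fixes f :: "'a::comm_monoid_add mpoly"
  shows "f = (\<Sum>e\<in>Poly_Mapping.keys f. Poly_Mapping.single e (Poly_Mapping.lookup f e))"
  by (rule poly_mapping_eqI) (auto simp: lookup_sum lookup_single when_def in_keys_iff)

text \<open>By bilinearity it suffices to multiply single monomials, whose exponents add.\<close>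

lemma meval_mult: "meval (f * g) z = meval f z * meval g z"
proof -
  have "meval (f * g) z = meval ((\<Sum>e\<in>Poly_Mapping.keys f. Poly_Mapping.single e (Poly_Mapping.lookup f e)) *
    (\<Sum>e\<in>Poly_Mapping.keys g. Poly_Mapping.single e (Poly_Mapping.lookup g e))) z"
    using mpoly_eq_sum_monomials[of f] mpoly_eq_sum_monomials[of g] by simp
  also have "\<dots> = meval f z * meval g z"
    unfolding meval_def[of f] meval_def[of g]
    by (simp add: sum_product mult_single meval_sum meval_single monomial_value_add mcoeff_def ac_simps)
  finally show ?thesis .
qed

lemma meval_one [simp]: "meval 1 z = 1"
  by (simp flip: single_one add: meval_single)

lemma meval_prod: "meval (prod f I) z = (\<Prod>i\<in>I. meval (f i) z)"
  by (induction I rule: infinite_finite_induct) (simp_all add: meval_mult)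

lemma meval_minus: "meval (- f) z = - meval f z" for f :: "'a::comm_ring_1 mpoly"
  by (metis add.right_inverse meval_add meval_zero minus_unique)

lemma meval_diff: "meval (f - g) z = meval f z - meval g z" for f :: "'a::comm_ring_1 mpoly"
  using meval_add[of f "- g"] by (simp add: meval_minus)

lemma meval_of_int: "meval (of_int k) z = (of_int k :: 'a::comm_ring_1)"
proof -
  have nat: "meval (of_nat k) z = (of_nat k :: 'a)" for k
    by (induction k) (simp_all add: meval_add)
  show ?thesis by (cases k) (simp_all add: nat meval_minus meval_diff)
qed

lemma meval_mconst [simp]: "meval (mconst c) z = c"
  by (simp add: mconst_def meval_single)

lemma meval_mvar [simp]: "meval (mvar i) z = z i"
  by (simp add: mvar_def meval_single)

text \<open>Distinct monomials are distinct characters of the multiplicative monoid of points, so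
  this is Dedekind's independence argument.\<close>

lemma monomials_independent:
  fixes c :: "(nat \<Rightarrow>\<^sub>0 nat) \<Rightarrow> complex"
  assumes "finite E"
    and "\<And>z. (\<Sum>e\<in>E. c e * (\<Prod>i\<in>Poly_Mapping.keys e. z i ^ Poly_Mapping.lookup e i)) = 0"
    and "e \<in> E"
  shows "c e = 0"
  using assms
proof (induction E arbitrary: c e rule: finite_induct)
  case (insert a E)
  define mon :: "(nat \<Rightarrow>\<^sub>0 nat) \<Rightarrow> (nat \<Rightarrow> complex) \<Rightarrow> complex" where
    "mon e z = (\<Prod>i\<in>Poly_Mapping.keys e. z i ^ Poly_Mapping.lookup e i)" for e z
  have vanish: "c a * mon a z + (\<Sum>e\<in>E. c e * mon e z) = 0" for z
    using insert.prems(1)[of z] insert.hyps by (simp add: mon_def)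
  have chi_mult: "mon e (\<lambda>i. z i * w i) = mon e z * mon e w" for e z w
    by (simp add: mon_def power_mult_distrib prod.distrib)
  have zero: "c b = 0" if "b \<in> E" for b
  proof -
    have "a \<noteq> b" using that insert.hyps by auto
    then obtain k where k: "Poly_Mapping.lookup a k \<noteq> Poly_Mapping.lookup b k"
      by (metis poly_mapping_eqI)
    \<comment> \<open>The point \<open>w\<close> separates the monomials \<open>a\<close> and
      \<open>b\<close>: it is 2 in a coordinate where their exponents differ, and distinct powers of
      2 are distinct.\<close>
    define w :: "nat \<Rightarrow> complex" where "w i = (if i = k then 2 else 1)" for i
    have chi_w: "mon e w = 2 ^ Poly_Mapping.lookup e k" for e
    proof -
      have "mon e w = (\<Prod>i\<in>insert k (Poly_Mapping.keys e). w i ^ Poly_Mapping.lookup e i)"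
        unfolding mon_def by (rule monomial_value_superset) auto
      also have "\<dots> = (\<Prod>i\<in>insert k (Poly_Mapping.keys e).
          if i = k then 2 ^ Poly_Mapping.lookup e k else 1)"
        by (intro prod.cong) (auto simp: w_def)
      also have "\<dots> = 2 ^ Poly_Mapping.lookup e k" by (subst prod.delta) auto
      finally show ?thesis .
    qed
    have "mon a w \<noteq> mon b w"
    proof
      assume "mon a w = mon b w"
      then have "(2::complex) ^ Poly_Mapping.lookup a k = 2 ^ Poly_Mapping.lookup b k"
        by (simp add: chi_w)
      then have "norm ((2::complex) ^ Poly_Mapping.lookup a k) = norm ((2::complex) ^ Poly_Mapping.lookup b k)"
        by simp
      then show False using k by (simp add: norm_power)
    qed
    \<comment> \<open>The relation at the product of \<open>z\<close> and \<open>w\<close>, minus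
      \<open>mon a w\<close> times the relation at \<open>z\<close>, no longer contains
      \<open>a\<close>; the induction hypothesis applies to this shorter relation.\<close>
    moreover have "c b * (mon b w - mon a w) = 0"
    proof (rule insert.IH[OF _ that])
      fix z
      have "(\<Sum>e\<in>E. c e * (mon e w - mon a w) * mon e z) =
          (c a * mon a (\<lambda>i. z i * w i) + (\<Sum>e\<in>E. c e * mon e (\<lambda>i. z i * w i)))
          - mon a w * (c a * mon a z + (\<Sum>e\<in>E. c e * mon e z))"
        by (simp add: chi_mult algebra_simps sum_distrib_left sum_subtractf)
      also have "\<dots> = 0" by (simp only: vanish) simp
      finally show "(\<Sum>e\<in>E. c e * (mon e w - mon a w) *
          (\<Prod>i\<in>Poly_Mapping.keys e. z i ^ Poly_Mapping.lookup e i)) = 0"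
        by (simp add: mon_def)
    qed
    ultimately show ?thesis by simp
  qed
  moreover have "c a = 0"
    using vanish[of "\<lambda>_. 1"] zero by (simp add: mon_def)
  ultimately show ?case using insert.prems(2) by auto
qed simp

lemma mpoly_eq_zero_if_meval_zero:
  fixes f :: "complex mpoly"
  assumes "\<And>z. meval f z = 0"
  shows "f = 0"
proof (rule poly_mapping_eqI)
  fix e
  have "mcoeff f e = 0" if "e \<in> Poly_Mapping.keys f"
    by (rule monomials_independent[of "Poly_Mapping.keys f"])
      (use assms that in \<open>auto simp: meval_def\<close>)
  then show "Poly_Mapping.lookup f e = Poly_Mapping.lookup 0 e"
    by (cases "e \<in> Poly_Mapping.keys f") (auto simp: mcoeff_def in_keys_iff)
qed

text \<open>Conjugating all coefficients of \<open>f\<close> gives a polynomial \<open>g\<close>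
  whose value at \<open>z\<close> is the conjugate of the value of \<open>f\<close> at the conjugate
  of \<open>z\<close>. By assumption \<open>f\<close> and \<open>g\<close> agree everywhere, so
  their coefficients agree.\<close>

lemma mcoeff_real_if_conjugation_invariant:
  fixes f :: "complex mpoly"
  assumes "\<And>z. cnj (meval f (\<lambda>i. cnj (z i))) = meval f z"
  shows "mcoeff f e \<in> \<real>"
proof -
  define g where "g = Poly_Mapping.map cnj f"
  have coeff: "Poly_Mapping.lookup g e = cnj (Poly_Mapping.lookup f e)" for e
    by (auto simp: g_def Poly_Mapping.map.rep_eq when_def)
  then have keys: "Poly_Mapping.keys g = Poly_Mapping.keys f"
    by (auto simp: in_keys_iff)
  have "meval g z = cnj (meval f (\<lambda>i. cnj (z i)))" for z
    by (simp add: meval_def keys mcoeff_def coeff)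
  then have "meval (f - g) z = 0" for z
    by (simp add: meval_diff assms)
  then have "f - g = 0" by (rule mpoly_eq_zero_if_meval_zero)
  then have "f = g" by simp
  then show ?thesis
    using coeff[of e] by (simp add: mcoeff_def Reals_cnj_iff)
qed

section \<open>Closure properties of the ring in the first \<open>n\<close> variables\<close>

lemma polys_zero: "0 \<in> polys n" by (simp add: polys_def)
lemma polys_one: "1 \<in> polys n" by (simp add: polys_def)
lemma polys_mconst: "mconst c \<in> polys n" by (simp add: polys_def mconst_def)
lemma polys_mvar: "i < n \<Longrightarrow> mvar i \<in> polys n" by (simp add: polys_def mvar_def)

lemma polys_add: "f \<in> polys n \<Longrightarrow> g \<in> polys n \<Longrightarrow> f + g \<in> polys n"
  using Poly_Mapping.keys_add[of f g] by (fastforce simp: polys_def)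

lemma polys_mult:
  assumes "f \<in> polys n" "g \<in> polys n"
  shows "f * g \<in> polys n"
  unfolding polys_def
proof (intro CollectI ballI)
  fix e assume "e \<in> Poly_Mapping.keys (f * g)"
  then obtain a b where e: "e = a + b" and "a \<in> Poly_Mapping.keys f" "b \<in> Poly_Mapping.keys g"
    using keys_mult[of f g] by blast
  then have "Poly_Mapping.keys a \<union> Poly_Mapping.keys b \<subseteq> {..<n}"
    using assms by (auto simp: polys_def)
  then show "Poly_Mapping.keys e \<subseteq> {..<n}"
    unfolding e using Poly_Mapping.keys_add[of a b] by blast
qed

lemma polys_sum: "(\<And>i. i \<in> I \<Longrightarrow> f i \<in> polys n) \<Longrightarrow> sum f I \<in> polys n"
  by (induction I rule: infinite_finite_induct) (auto intro: polys_zero polys_add)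

lemma polys_prod: "(\<And>i. i \<in> I \<Longrightarrow> f i \<in> polys n) \<Longrightarrow> prod f I \<in> polys n"
  by (induction I rule: infinite_finite_induct) (auto intro: polys_one polys_mult)

lemma polys_of_int: "(of_int k :: 'a::comm_ring_1 mpoly) \<in> polys n"
proof -
  have uminus: "- f \<in> polys n" if "f \<in> polys n" for f :: "'a mpoly"
    using that by (simp add: polys_def)
  have "(of_nat k :: 'a mpoly) \<in> polys n" for k
    by (induction k) (auto intro: polys_zero polys_one polys_add)
  then show ?thesis by (cases k) (auto intro!: uminus polys_add polys_one simp del: of_nat_Suc)
qed

section \<open>Principal minors\<close>

text \<open>The Leibniz formula over permutations of the index set itself avoids the renumbering
  that \<open>submatrix\<close> performs, so minors for different sets can be compared
  directly.\<close>

definition minor :: "('i \<Rightarrow> 'i \<Rightarrow> 'a::comm_ring_1) \<Rightarrow> 'i set \<Rightarrow> 'a" where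
  "minor M S = (\<Sum>p | p permutes S. of_int (sign p) * (\<Prod>i\<in>S. M i (p i)))"

lemma minor_cong:
  assumes "\<And>a b. a \<in> S \<Longrightarrow> b \<in> S \<Longrightarrow> M a b = N a b"
  shows "minor M S = minor N S"
  unfolding minor_def
  by (intro sum.cong arg_cong2[of _ _ _ _ "(*)"] prod.cong) (auto simp: assms permutes_in_image)

text \<open>Conjugation by \<open>h\<close> maps permutations of \<open>S\<close> bijectively to
  permutations of its image and preserves the sign.\<close>

lemma minor_reindex:
  assumes "finite S" "inj_on h S"
  shows "minor M (h ` S) = minor (\<lambda>a b. M (h a) (h b)) S"
proof -
  have eq: "(\<lambda>\<pi> x. if x \<in> h ` S then h (\<pi> (inv_into S h x)) else x) = map_permutation S h"
    by (auto simp: map_permutation_def restrict_id_def fun_eq_iff)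
  have bij: "bij_betw (map_permutation S h) {p. p permutes S} {p. p permutes h ` S}"
    using bij_betw_permutations[of h S "h ` S"] assms by (simp add: eq bij_betw_imageI)
  have "minor M (h ` S) = (\<Sum>p | p permutes S. of_int (sign (map_permutation S h p)) *
      (\<Prod>i\<in>h ` S. M i (map_permutation S h p i)))"
    unfolding minor_def by (rule sum.reindex_bij_betw[OF bij, symmetric])
  also have "\<dots> = minor (\<lambda>a b. M (h a) (h b)) S"
    unfolding minor_def using assms
    by (intro sum.cong)
      (auto simp: sign_map_permutation prod.reindex map_permutation_apply intro!: prod.cong)
  finally show ?thesis .
qed

text \<open>Replacing \<open>p\<close> by its inverse keeps the sign, and reordering the product
  along \<open>p\<close> exchanges rows and columns. For infinite \<open>S\<close> all products are
  1 by convention.\<close>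

lemma minor_transpose: "minor (\<lambda>a b. M b a) S = minor M S"
proof (cases "finite S")
  case True
  have "minor M S = (\<Sum>p | p permutes S. of_int (sign (inv_into UNIV p)) * (\<Prod>i\<in>S. M i (inv_into UNIV p i)))"
    unfolding minor_def by (rule sum_permutations_inverse)
  also have "\<dots> = minor (\<lambda>a b. M b a) S"
    unfolding minor_def
  proof (intro sum.cong refl)
    fix p assume "p \<in> {p. p permutes S}"
    then have p: "p permutes S" by simp
    have "(\<Prod>i\<in>S. M i (inv_into UNIV p i)) = (\<Prod>i\<in>S. M (p i) (inv_into UNIV p (p i)))"
      using prod.permute[OF p, of "\<lambda>i. M i (inv_into UNIV p i)"] by simp
    then show "of_int (sign (inv_into UNIV p)) * (\<Prod>i\<in>S. M i (inv_into UNIV p i)) =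
        of_int (sign p) * (\<Prod>i\<in>S. M (p i) i)"
      using p True by (simp add: permutes_inverses sign_inverse permutes_imp_permutation)
  qed
  finally show ?thesis ..
qed (simp add: minor_def)

text \<open>Multiply out each product: \<open>S\<close> collects the rows in which the entry of
  \<open>C\<close> is taken. In the other rows only the diagonal contributes, so a permutation with
  nonzero term fixes every index outside \<open>S\<close> and is a permutation of
  \<open>S\<close>.\<close>

lemma minor_add_diag:
  assumes "finite U"
  shows "minor (\<lambda>a b. C a b + (if a = b then x a else 0)) U =
    (\<Sum>S\<in>Pow U. minor C S * (\<Prod>i\<in>U - S. x i))"
proof -
  let ?t = "\<lambda>p S. of_int (sign p) * ((\<Prod>i\<in>S. C i (p i)) * (\<Prod>i\<in>U - S. if i = p i then x i else 0))"
  have "minor (\<lambda>a b. C a b + (if a = b then x a else 0)) U = (\<Sum>p | p permutes U. \<Sum>S\<in>Pow U. ?t p S)"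
    unfolding minor_def prod_add[OF assms] sum_distrib_left ..
  also have "\<dots> = (\<Sum>S\<in>Pow U. \<Sum>p | p permutes U. ?t p S)"
    by (rule sum.swap)
  also have "\<dots> = (\<Sum>S\<in>Pow U. minor C S * (\<Prod>i\<in>U - S. x i))"
  proof (intro sum.cong refl)
    fix S assume "S \<in> Pow U"
    then have S: "S \<subseteq> U" by simp
    have "(\<Sum>p | p permutes U. ?t p S) = (\<Sum>p | p permutes S. ?t p S)"
    proof (rule sum.mono_neutral_right)
      show "finite {p. p permutes U}" using assms by (rule finite_permutations)
      show "{p. p permutes S} \<subseteq> {p. p permutes U}" using S by (auto intro: permutes_subset)
      show "\<forall>p\<in>{p. p permutes U} - {p. p permutes S}. ?t p S = 0"
      proof
        fix p assume "p \<in> {p. p permutes U} - {p. p permutes S}"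
        then obtain i where "i \<in> U - S" "i \<noteq> p i" using permutes_superset[of p U S] by force
        then have "(\<Prod>i\<in>U - S. if i = p i then x i else 0) = 0"
          using assms by (intro prod_zero bexI[of _ i]) auto
        then show "?t p S = 0" by simp
      qed
    qed
    also have "\<dots> = (\<Sum>p | p permutes S. of_int (sign p) * (\<Prod>i\<in>S. C i (p i)) * (\<Prod>i\<in>U - S. x i))"
    proof (intro sum.cong refl)
      fix p assume "p \<in> {p. p permutes S}"
      then have "(\<Prod>i\<in>U - S. if i = p i then x i else 0) = (\<Prod>i\<in>U - S. x i)"
        by (intro prod.cong) (auto simp: permutes_not_in)
      then show "?t p S = of_int (sign p) * (\<Prod>i\<in>S. C i (p i)) * (\<Prod>i\<in>U - S. x i)"
        by (simp add: ac_simps)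
    qed
    finally show "(\<Sum>p | p permutes U. ?t p S) = minor C S * (\<Prod>i\<in>U - S. x i)"
      by (simp add: minor_def sum_distrib_right)
  qed
  finally show ?thesis .
qed

section \<open>Library determinants as minors, and kernel vectors of singular minors\<close>

lemma det_eq_minor:
  assumes "A \<in> carrier_mat n n"
  shows "det A = minor (\<lambda>a b. A $$ (a, b)) {..<n}"
  unfolding minor_def det_def'[OF assms] by (simp add: atLeast0LessThan)

lemma pick_bij_betw:
  assumes "finite S"
  shows "bij_betw (pick S) {..<card S} S"
proof -
  have "inj_on (pick S) {..<card S}"
    by (rule inj_onI) (metis lessThan_iff nat_neq_iff pick_mono_le less_irrefl)
  moreover have "pick S ` {..<card S} \<subseteq> S"
    by (auto intro: pick_in_set_le)
  ultimately show ?thesis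
    using assms card_subset_eq[of S "pick S ` {..<card S}"] by (simp add: bij_betw_def card_image)
qed

lemma principal_submatrix_eq_mat:
  assumes "A \<in> carrier_mat n n" "S \<subseteq> {..<n}"
  shows "principal_submatrix A S =
    Matrix.mat (card S) (card S) (\<lambda>(i, j). A $$ (pick S i, pick S j))"
proof -
  have "{i. i < n \<and> i \<in> S} = S" using assms by auto
  then show ?thesis
    using assms by (simp add: principal_submatrix_def submatrix_def)
qed

lemma det_principal_submatrix:
  assumes "A \<in> carrier_mat n n" "S \<subseteq> {..<n}"
  shows "det (principal_submatrix A S) = minor (\<lambda>a b. A $$ (a, b)) S"
proof -
  have "finite S" using assms(2) finite_subset by blast
  then have pick: "bij_betw (pick S) {..<card S} S" by (rule pick_bij_betw)
  have "det (principal_submatrix A S) = minor (\<lambda>a b. A $$ (pick S a, pick S b)) {..<card S}"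
    by (subst det_eq_minor[of _ "card S"])
      (auto simp: principal_submatrix_eq_mat[OF assms] intro!: minor_cong)
  also have "\<dots> = minor (\<lambda>a b. A $$ (a, b)) (pick S ` {..<card S})"
    by (rule minor_reindex[symmetric]) (use pick in \<open>auto simp: bij_betw_def\<close>)
  finally show ?thesis using pick by (simp add: bij_betw_def)
qed

lemma minor_zero_kernel:
  fixes M :: "'i \<Rightarrow> 'i \<Rightarrow> 'a::field"
  assumes "finite S" "minor M S = 0"
  obtains v where "\<exists>i\<in>S. v i \<noteq> 0" "\<And>i. i \<in> S \<Longrightarrow> (\<Sum>j\<in>S. M i j * v j) = 0"
proof -
  obtain h where h: "bij_betw h {..<card S} S"
    using ex_bij_betw_nat_finite[OF assms(1)] by (auto simp: atLeast0LessThan)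
  let ?n = "card S"
  define A where "A = Matrix.mat ?n ?n (\<lambda>(a, b). M (h a) (h b))"
  have A: "A \<in> carrier_mat ?n ?n" by (simp add: A_def)
  have "det A = minor (\<lambda>a b. M (h a) (h b)) {..<?n}"
    unfolding det_eq_minor[OF A] by (rule minor_cong) (simp add: A_def)
  also have "\<dots> = minor M (h ` {..<?n})"
    by (rule minor_reindex[symmetric]) (use h in \<open>auto simp: bij_betw_def\<close>)
  finally have "det A = 0" using h assms by (simp add: bij_betw_def)
  then obtain u where u: "u \<in> carrier_vec ?n" "u \<noteq> 0\<^sub>v ?n" "A *\<^sub>v u = 0\<^sub>v ?n"
    using det_0_iff_vec_prod_zero[OF A] by auto
  define g where "g = inv_into {..<?n} h"
  have gh: "g (h a) = a" if "a < ?n" for a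
    using that h by (simp add: g_def bij_betw_def)
  obtain a where a: "a < ?n" "u $ a \<noteq> 0"
    using u(1,2) by (metis carrier_vecD eq_vecI index_zero_vec(1) index_zero_vec(2))
  show thesis
  proof
    show "\<exists>i\<in>S. u $ g i \<noteq> 0"
      using a h by (intro bexI[of _ "h a"]) (auto simp: gh bij_betw_def)
    fix i assume "i \<in> S"
    then obtain b where b: "b < ?n" "i = h b" using h by (auto simp: bij_betw_def)
    have "(\<Sum>j\<in>S. M i j * u $ g j) = (\<Sum>c<?n. M i (h c) * u $ g (h c))"
      by (rule sum.reindex_bij_betw[OF h, symmetric])
    also have "\<dots> = (\<Sum>c<?n. A $$ (b, c) * u $ c)"
      by (intro sum.cong) (auto simp: gh b A_def)
    also have "\<dots> = (A *\<^sub>v u) $ b"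
      using A u(1) b by (simp add: scalar_prod_def atLeast0LessThan)
    finally show "(\<Sum>j\<in>S. M i j * u $ g j) = 0" using u(3) b by simp
  qed
qed

text \<open>If the minor vanished, a kernel vector \<open>v\<close> would satisfy
  \<open>C v = - x v\<close> on \<open>V\<close>. Pairing with \<open>v\<close> gives the value of
  the form as minus the sum of \<open>x a\<close> times the squared modulus of \<open>v a\<close>,
  whose imaginary part is at most 0, against \<open>pos\<close>.\<close>

lemma minor_add_diag_nonzero:
  fixes C :: "'i \<Rightarrow> 'i \<Rightarrow> complex"
  assumes "finite U" "V \<subseteq> U"
    and pos: "\<And>v. \<exists>i\<in>U. v i \<noteq> 0 \<Longrightarrow> Im (\<Sum>a\<in>U. \<Sum>b\<in>U. cnj (v a) * C a b * v b) > 0"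
    and x: "\<And>i. i \<in> V \<Longrightarrow> Im (x i) \<ge> 0"
  shows "minor (\<lambda>a b. C a b + (if a = b then x a else 0)) V \<noteq> 0"
proof
  have "finite V" using assms finite_subset by blast
  moreover assume "minor (\<lambda>a b. C a b + (if a = b then x a else 0)) V = 0"
  ultimately obtain v where v: "\<exists>i\<in>V. v i \<noteq> 0"
    "\<And>i. i \<in> V \<Longrightarrow> (\<Sum>j\<in>V. (C i j + (if i = j then x i else 0)) * v j) = 0"
    by (rule minor_zero_kernel) blast
  define w where "w i = (if i \<in> V then v i else 0)" for i
  have row: "(\<Sum>b\<in>V. C a b * v b) = - x a * v a" if "a \<in> V" for a
  proof -
    have "(\<Sum>b\<in>V. (C a b + (if a = b then x a else 0)) * v b) =
        (\<Sum>b\<in>V. C a b * v b) + (\<Sum>b\<in>V. if a = b then x a * v b else 0)"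
      by (auto simp: distrib_right sum.distrib intro!: sum.cong)
    also have "(\<Sum>b\<in>V. if a = b then x a * v b else 0) = x a * v a"
      using that \<open>finite V\<close> by simp
    finally show ?thesis using v(2)[OF that] by (simp add: eq_neg_iff_add_eq_0)
  qed
  have "(\<Sum>a\<in>U. \<Sum>b\<in>U. cnj (w a) * C a b * w b) = (\<Sum>a\<in>V. \<Sum>b\<in>U. cnj (w a) * C a b * w b)"
    by (rule sum.mono_neutral_right) (use assms in \<open>auto simp: w_def\<close>)
  also have "\<dots> = (\<Sum>a\<in>V. \<Sum>b\<in>V. cnj (v a) * C a b * v b)"
  proof (rule sum.cong[OF refl])
    fix a assume "a \<in> V"
    have "(\<Sum>b\<in>U. cnj (w a) * C a b * w b) = (\<Sum>b\<in>V. cnj (w a) * C a b * w b)"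
      by (rule sum.mono_neutral_right) (use assms in \<open>auto simp: w_def\<close>)
    then show "(\<Sum>b\<in>U. cnj (w a) * C a b * w b) = (\<Sum>b\<in>V. cnj (v a) * C a b * v b)"
      using \<open>a \<in> V\<close> by (simp add: w_def)
  qed
  also have "\<dots> = (\<Sum>a\<in>V. cnj (v a) * (\<Sum>b\<in>V. C a b * v b))"
    by (simp add: sum_distrib_left mult.assoc)
  also have "\<dots> = (\<Sum>a\<in>V. cnj (v a) * (- x a * v a))"
    by (intro sum.cong) (simp_all only: row)
  also have "\<dots> = (\<Sum>a\<in>V. - x a * of_real ((cmod (v a))\<^sup>2))"
    by (simp only: complex_norm_square ac_simps mult_minus_left mult_minus_right)
  finally have "Im (\<Sum>a\<in>U. \<Sum>b\<in>U. cnj (w a) * C a b * w b) =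
      - (\<Sum>a\<in>V. Im (x a) * (cmod (v a))\<^sup>2)"
    by (simp add: sum_negf)
  moreover have "(\<Sum>a\<in>V. Im (x a) * (cmod (v a))\<^sup>2) \<ge> 0"
    by (intro sum_nonneg mult_nonneg_nonneg) (auto simp: x)
  moreover have "Im (\<Sum>a\<in>U. \<Sum>b\<in>U. cnj (w a) * C a b * w b) > 0"
    by (rule pos) (use v(1) assms(2) in \<open>auto simp: w_def\<close>)
  ultimately show False by simp
qed

section \<open>Mixed sums over ordered set partitions\<close>

text \<open>The sum in \<open>mixed_det\<close> with arbitrary set functions in place of
  determinants and an arbitrary ground set. Deleting an index then only shrinks \<open>U\<close>,
  and the same formula serves polynomial and complex entries.\<close>

definition set_mix :: "(nat \<Rightarrow> 'i set \<Rightarrow> 'a::comm_ring_1) \<Rightarrow> nat \<Rightarrow> 'i set \<Rightarrow> 'a" where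
  "set_mix f m U =
     (\<Sum>S \<in> {S \<in> {..<m} \<rightarrow>\<^sub>E Pow U. disjoint_family_on S {..<m} \<and> (\<Union>i<m. S i) = U}.
        \<Prod>i<m. f i (S i))"

lemma set_mix_cong:
  assumes "\<And>i S. i < m \<Longrightarrow> S \<subseteq> U \<Longrightarrow> f i S = g i S"
  shows "set_mix f m U = set_mix g m U"
  unfolding set_mix_def by (intro sum.cong prod.cong) (auto intro!: assms)

text \<open>Taking images and preimages under \<open>h\<close> in each component gives mutually
  inverse maps between ordered partitions. This later undoes the renumbering of principal
  submatrices by \<open>pick\<close>.\<close>

lemma set_mix_reindex:
  assumes inj: "inj_on h U"
  shows "set_mix f m (h ` U) = set_mix (\<lambda>i S. f i (h ` S)) m U"
  unfolding set_mix_def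
proof (rule sum.reindex_bij_witness[of _
      "\<lambda>S. \<lambda>i\<in>{..<m}. h ` S i" "\<lambda>S. \<lambda>i\<in>{..<m}. {u \<in> U. h u \<in> S i}"])
  fix S assume S: "S \<in> {S \<in> {..<m} \<rightarrow>\<^sub>E Pow (h ` U). disjoint_family_on S {..<m} \<and> (\<Union>i<m. S i) = h ` U}"
  then have sub: "S i \<subseteq> h ` U" if "i < m" for i using that by auto
  have img: "h ` {u \<in> U. h u \<in> S i} = S i" if "i < m" for i
    using sub[OF that] by auto
  show "(\<lambda>i\<in>{..<m}. h ` (\<lambda>i\<in>{..<m}. {u \<in> U. h u \<in> S i}) i) = S"
    by (rule ext) (use S in \<open>auto simp: img PiE_iff extensional_def\<close>)
  have "S i \<inter> S j = {}" if "i < m" "j < m" "i \<noteq> j" for i j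
    using S that by (auto simp: disjoint_family_on_def)
  then have "disjoint_family_on (\<lambda>i\<in>{..<m}. {u \<in> U. h u \<in> S i}) {..<m}"
    unfolding disjoint_family_on_def by (intro ballI impI) (simp, blast)
  moreover have "(\<Union>i<m. {u \<in> U. h u \<in> S i}) = U"
  proof -
    have "h u \<in> (\<Union>i<m. S i)" if "u \<in> U" for u using S that by simp
    then show ?thesis by blast
  qed
  ultimately show "(\<lambda>i\<in>{..<m}. {u \<in> U. h u \<in> S i}) \<in>
      {S \<in> {..<m} \<rightarrow>\<^sub>E Pow U. disjoint_family_on S {..<m} \<and> (\<Union>i<m. S i) = U}"
    by auto
  show "(\<Prod>i<m. f i (h ` (\<lambda>i\<in>{..<m}. {u \<in> U. h u \<in> S i}) i)) = (\<Prod>i<m. f i (S i))"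
    by (intro prod.cong) (auto simp: img)
next
  fix S assume S: "S \<in> {S \<in> {..<m} \<rightarrow>\<^sub>E Pow U. disjoint_family_on S {..<m} \<and> (\<Union>i<m. S i) = U}"
  then have sub: "S i \<subseteq> U" if "i < m" for i using that by auto
  have img: "{u \<in> U. h u \<in> h ` S i} = S i" if "i < m" for i
    using sub[OF that] inj by (auto dest: inj_onD)
  show "(\<lambda>i\<in>{..<m}. {u \<in> U. h u \<in> (\<lambda>i\<in>{..<m}. h ` S i) i}) = S"
    by (rule ext) (use S in \<open>auto simp: img PiE_iff extensional_def\<close>)
  have "disjoint_family_on (\<lambda>i\<in>{..<m}. h ` S i) {..<m}"
    unfolding disjoint_family_on_def
  proof (intro ballI impI)
    fix i j assume ij: "i \<in> {..<m}" "j \<in> {..<m}" "i \<noteq> j"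
    then have "h ` S i \<inter> h ` S j = h ` (S i \<inter> S j)"
      using inj_on_image_Int[OF inj sub sub] by auto
    also have "S i \<inter> S j = {}" using S ij by (auto simp: disjoint_family_on_def)
    finally show "(\<lambda>i\<in>{..<m}. h ` S i) i \<inter> (\<lambda>i\<in>{..<m}. h ` S i) j = {}" using ij by simp
  qed
  moreover have "(\<Union>i<m. h ` S i) = h ` U" using S by auto
  ultimately show "(\<lambda>i\<in>{..<m}. h ` S i) \<in>
      {S \<in> {..<m} \<rightarrow>\<^sub>E Pow (h ` U). disjoint_family_on S {..<m} \<and> (\<Union>i<m. S i) = h ` U}"
    using sub by auto
qed

text \<open>Split off the last set \<open>T\<close>; the other \<open>m\<close> sets form an ordered
  partition of its complement. Restricting to \<open>{..<m}\<close> keeps the shorter tuple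
  extensional.\<close>

lemma set_mix_Suc:
  assumes "finite U"
  shows "set_mix f (Suc m) U = (\<Sum>T\<in>Pow U. f m T * set_mix f m (U - T))"
proof -
  let ?P = "\<lambda>m U. {S \<in> {..<m} \<rightarrow>\<^sub>E Pow U. disjoint_family_on S {..<m} \<and> (\<Union>i<m. S i) = U}"
  have fin: "finite (?P m V)" if "V \<subseteq> U" for V
    using that assms by (intro finite_subset[OF _ finite_PiE[of "{..<m}" "\<lambda>_. Pow V"]])
      (auto intro: finite_subset)
  have "(\<Sum>T\<in>Pow U. f m T * set_mix f m (U - T)) =
      (\<Sum>T\<in>Pow U. \<Sum>S\<in>?P m (U - T). f m T * (\<Prod>i<m. f i (S i)))"
    by (simp add: set_mix_def sum_distrib_left)
  also have "\<dots> = (\<Sum>(T, S)\<in>Sigma (Pow U) (\<lambda>T. ?P m (U - T)). f m T * (\<Prod>i<m. f i (S i)))"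
    using assms fin by (intro sum.Sigma) auto
  also have "\<dots> = set_mix f (Suc m) U"
    unfolding set_mix_def
  proof (rule sum.reindex_bij_witness[of _
        "\<lambda>S. (S m, \<lambda>i\<in>{..<m}. S i)" "\<lambda>(T, S). S(m := T)"])
    fix S assume S: "S \<in> ?P (Suc m) U"
    then have sub: "S i \<subseteq> U" if "i < Suc m" for i using that by auto
    have disj: "S i \<inter> S j = {}" if "i < Suc m" "j < Suc m" "i \<noteq> j" for i j
      using S that by (auto simp: disjoint_family_on_def)
    have un: "(\<Union>i<Suc m. S i) = U" using S by auto
    show "(case (S m, \<lambda>i\<in>{..<m}. S i) of (T, S) \<Rightarrow> S(m := T)) = S"
      using S by (auto simp: PiE_def extensional_def restrict_def fun_eq_iff)
    have "S i \<subseteq> U - S m" if "i < m" for i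
      using sub[of i] disj[of i m] that by auto
    moreover have "(\<Union>i<m. S i) = U - S m"
    proof
      show "(\<Union>i<m. S i) \<subseteq> U - S m" using calculation by blast
      show "U - S m \<subseteq> (\<Union>i<m. S i)" using un by (auto simp: lessThan_Suc)
    qed
    ultimately show "(S m, \<lambda>i\<in>{..<m}. S i) \<in> Sigma (Pow U) (\<lambda>T. ?P m (U - T))"
      using sub[of m] disj by (auto simp: disjoint_family_on_def)
  next
    fix TS assume TS: "TS \<in> Sigma (Pow U) (\<lambda>T. ?P m (U - T))"
    obtain T S where eq: "TS = (T, S)" by force
    have T: "T \<subseteq> U" and S: "S \<in> {..<m} \<rightarrow>\<^sub>E Pow (U - T)" "disjoint_family_on S {..<m}"
        "(\<Union>i<m. S i) = U - T"
      using TS eq by auto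
    have sub: "S i \<subseteq> U - T" if "i < m" for i using S(1) that by auto
    show "((case TS of (T, S) \<Rightarrow> S(m := T)) m, \<lambda>i\<in>{..<m}. (case TS of (T, S) \<Rightarrow> S(m := T)) i) = TS"
      using S(1) by (auto simp: eq PiE_def extensional_def restrict_def fun_eq_iff)
    have "S(m := T) \<in> {..<Suc m} \<rightarrow>\<^sub>E Pow U"
      using S(1) T by (auto simp: PiE_def extensional_def less_Suc_eq Pi_def)
    moreover have "disjoint_family_on (S(m := T)) {..<Suc m}"
      unfolding disjoint_family_on_def
    proof (intro ballI impI)
      fix i j assume ij: "i \<in> {..<Suc m}" "j \<in> {..<Suc m}" "i \<noteq> j"
      then consider "i < m" "j < m" | "i = m" "j < m" | "i < m" "j = m" by force
      then show "(S(m := T)) i \<inter> (S(m := T)) j = {}"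
        using S(2) sub[of i] sub[of j] ij by cases (auto simp: disjoint_family_on_def)
    qed
    moreover have "(\<Union>i<Suc m. (S(m := T)) i) = U"
      using S(3) T by (auto simp: lessThan_Suc)
    ultimately show "(case TS of (T, S) \<Rightarrow> S(m := T)) \<in> ?P (Suc m) U"
      by (simp add: eq)
    show "(\<Prod>i<Suc m. f i ((case TS of (T, S) \<Rightarrow> S(m := T)) i)) =
        (case TS of (T, S) \<Rightarrow> f m T * (\<Prod>i<m. f i (S i)))"
      by (simp add: eq mult.commute)
  qed
  finally show ?thesis ..
qed

section \<open>Nonvanishing by elimination of one variable at a time\<close>

text \<open>The ratio of the two top coefficients is minus the sum of the roots, all of which lie in the
  open lower half plane.\<close>

lemma Im_top_coeff_ratio_pos:
  fixes p :: "complex poly"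
  assumes "degree p = Suc d" "\<And>t. Im t \<ge> 0 \<Longrightarrow> poly p t \<noteq> 0"
  shows "Im (coeff p d / coeff p (Suc d)) > 0"
  using assms
proof (induction d arbitrary: p)
  case (0 p)
  obtain r where r: "poly p r = 0"
    using fundamental_theorem_of_algebra[of p] 0 by (auto simp: constant_degree)
  then obtain q where q: "p = [:-r, 1:] * q" by (auto simp: poly_eq_0_iff_dvd elim: dvdE)
  have "q \<noteq> 0" using 0 q by auto
  then have "degree p = Suc (degree q)" unfolding q by (subst degree_mult_eq) auto
  then have dq: "degree q = 0" using 0 by simp
  then have "coeff q 0 \<noteq> 0" using \<open>q \<noteq> 0\<close> by (metis leading_coeff_neq_0)
  moreover have "coeff p 0 = - r * coeff q 0" "coeff p (Suc 0) = coeff q 0"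
    using dq by (simp_all add: q coeff_eq_0)
  ultimately have "coeff p 0 / coeff p (Suc 0) = - r" by simp
  moreover have "Im r < 0" using r 0(2)[of r] by force
  ultimately show ?case by simp
next
  case (Suc d p)
  obtain r where r: "poly p r = 0"
    using fundamental_theorem_of_algebra[of p] Suc.prems by (auto simp: constant_degree)
  then obtain q where q: "p = [:-r, 1:] * q" by (auto simp: poly_eq_0_iff_dvd elim: dvdE)
  have "q \<noteq> 0" using Suc.prems q by auto
  then have "degree p = Suc (degree q)" unfolding q by (subst degree_mult_eq) auto
  then have dq: "degree q = Suc d" using Suc.prems by simp
  then have lead: "coeff q (Suc d) \<noteq> 0" using \<open>q \<noteq> 0\<close> by (metis leading_coeff_neq_0)
  have "Im (coeff q d / coeff q (Suc d)) > 0"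
    by (rule Suc.IH[OF dq]) (use Suc.prems(2) q in auto)
  \<comment> \<open>The linear factor subtracts \<open>r\<close> from the ratio of the two top
    coefficients, and \<open>r\<close> has negative imaginary part.\<close>
  moreover have "coeff p (Suc d) = coeff q d - r * coeff q (Suc d)"
    "coeff p (Suc (Suc d)) = coeff q (Suc d)"
    using dq by (simp_all add: q coeff_eq_0)
  then have "coeff p (Suc d) / coeff p (Suc (Suc d)) = coeff q d / coeff q (Suc d) - r"
    using lead by (simp add: diff_divide_distrib)
  moreover have "Im r < 0" using r Suc.prems(2)[of r] by force
  ultimately show ?case by simp
qed

text \<open>Expanding \<open>\<Prod>j<m. det (C\<^sub>j[V] + diag x)\<close> by minors gives a sum over all tuples of subsets of
  \<open>V\<close>.  For each \<open>k \<in> K\<close>, only the coefficient of \<open>x\<^sub>k ^ (m - 1)\<close> is kept here, so that \<open>k\<close> lies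
  in exactly one set of the tuple.\<close>

definition partial_mix ::
  "(nat \<Rightarrow> 'i set \<Rightarrow> complex) \<Rightarrow> nat \<Rightarrow> 'i set \<Rightarrow> 'i set \<Rightarrow> ('i \<Rightarrow> complex) \<Rightarrow> complex" where
  "partial_mix f m V K x =
     (\<Sum>S | S \<in> {..<m} \<rightarrow>\<^sub>E Pow V \<and> (\<forall>k\<in>K. \<exists>!j. j < m \<and> k \<in> S j).
        (\<Prod>j<m. f j (S j)) * (\<Prod>i\<in>V - K. x i ^ card {j. j < m \<and> i \<notin> S j}))"

text \<open>Distributing the product over \<open>j\<close>, the index \<open>i\<close> contributes
  one factor \<open>x i\<close> for each \<open>j\<close> whose set misses \<open>i\<close>. With
  minors for \<open>f\<close>, the right side is the product of determinants with added diagonal, by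
  \<open>minor_add_diag\<close>.\<close>

lemma partial_mix_empty:
  assumes "finite V"
  shows "partial_mix f m V {} x = (\<Prod>j<m. \<Sum>S\<in>Pow V. f j S * (\<Prod>i\<in>V - S. x i))"
proof -
  have "(\<Prod>j<m. \<Sum>S\<in>Pow V. f j S * (\<Prod>i\<in>V - S. x i)) =
      (\<Sum>S\<in>{..<m} \<rightarrow>\<^sub>E Pow V. \<Prod>j<m. f j (S j) * (\<Prod>i\<in>V - S j. x i))"
    by (rule prod_sum_PiE) (use assms in auto)
  also have "\<dots> = partial_mix f m V {} x"
    unfolding partial_mix_def
  proof (rule sum.cong)
    fix S
    have "(\<Prod>j<m. \<Prod>i\<in>V - S j. x i) = (\<Prod>j<m. \<Prod>i\<in>V. if i \<notin> S j then x i else 1)"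
      using assms by (intro prod.cong prod.mono_neutral_cong_left) auto
    also have "\<dots> = (\<Prod>i\<in>V. \<Prod>j<m. if i \<notin> S j then x i else 1)"
      by (rule prod.swap)
    also have "\<dots> = (\<Prod>i\<in>V. x i ^ card {j. j < m \<and> i \<notin> S j})"
    proof (rule prod.cong[OF refl])
      fix i
      have "(\<Prod>j<m. if i \<notin> S j then x i else 1) = (\<Prod>j\<in>{j. j < m \<and> i \<notin> S j}. x i)"
        by (rule prod.mono_neutral_cong_right) auto
      then show "(\<Prod>j<m. if i \<notin> S j then x i else 1) = x i ^ card {j. j < m \<and> i \<notin> S j}"
        by simp
    qed
    finally show "(\<Prod>j<m. f j (S j) * (\<Prod>i\<in>V - S j. x i)) =
        (\<Prod>j<m. f j (S j)) * (\<Prod>i\<in>V - {}. x i ^ card {j. j < m \<and> i \<notin> S j})"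
      by (simp add: prod.distrib)
  qed auto
  finally show ?thesis ..
qed

text \<open>Links the exponent \<open>m - 1\<close> of \<open>x k\<close> to the condition that
  exactly one set contains \<open>k\<close>. For \<open>m = 0\<close> truncated subtraction would
  make the left side true and the right side false.\<close>

lemma card_complement_eq_pred:
  assumes "m \<ge> 1"
  shows "card {j. j < m \<and> \<not> P j} = m - 1 \<longleftrightarrow> (\<exists>!j. j < m \<and> P j)"
proof -
  have "{j. j < m \<and> \<not> P j} = {..<m} - {j. j < m \<and> P j}" by auto
  then have "card {j. j < m \<and> \<not> P j} = m - card {j. j < m \<and> P j}"
    by (simp only:) (subst card_Diff_subset, auto)
  moreover have "card {j. j < m \<and> P j} \<le> m"
    using card_mono[of "{..<m}" "{j. j < m \<and> P j}"] by auto
  ultimately have "card {j. j < m \<and> \<not> P j} = m - 1 \<longleftrightarrow> card {j. j < m \<and> P j} = 1"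
    using assms by linarith
  also have "\<dots> \<longleftrightarrow> (\<exists>!j. j < m \<and> P j)"
    by (simp add: card_1_singleton_iff set_eq_iff Ex1_def) blast
  finally show ?thesis .
qed

text \<open>Induction on \<open>K\<close>, for all \<open>V\<close> and \<open>x\<close>
  simultaneously. The induction hypothesis is used twice: on \<open>V\<close>, to exclude roots of
  \<open>p\<close> in the closed upper half plane, and on \<open>V - {k}\<close>, to make its
  leading coefficient nonzero.\<close>

lemma partial_mix_nonzero:
  fixes f :: "nat \<Rightarrow> 'i set \<Rightarrow> complex"
  assumes m: "m \<ge> 1" and "finite K" "finite U"
    and f: "\<And>j V x. j < m \<Longrightarrow> V \<subseteq> U \<Longrightarrow> (\<And>i. i \<in> V \<Longrightarrow> Im (x i) \<ge> 0) \<Longrightarrow>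
      (\<Sum>S\<in>Pow V. f j S * (\<Prod>i\<in>V - S. x i)) \<noteq> 0"
    and "K \<subseteq> V" "V \<subseteq> U" "\<And>i. i \<in> V \<Longrightarrow> Im (x i) \<ge> 0"
  shows "partial_mix f m V K x \<noteq> 0"
  using assms(2,5-)
proof (induction K arbitrary: V x rule: finite_induct)
  case empty
  then have "finite V" using assms(3) finite_subset by blast
  then show ?case using f empty.prems by (simp add: partial_mix_empty)
next
  case (insert k K V x)
  have finV: "finite V" using insert.prems assms(3) finite_subset by blast
  define T where "T = {S. S \<in> {..<m} \<rightarrow>\<^sub>E Pow V \<and> (\<forall>k\<in>K. \<exists>!j. j < m \<and> k \<in> S j)}"
  have finT: "finite T"
    unfolding T_def using finV by (intro finite_subset[OF _ finite_PiE[of "{..<m}" "\<lambda>_. Pow V"]]) auto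
  define w where "w S = (\<Prod>j<m. f j (S j)) * (\<Prod>i\<in>V - insert k K. x i ^ card {j. j < m \<and> i \<notin> S j})" for S
  define d where "d S = card {j. j < m \<and> k \<notin> S j}" for S :: "nat \<Rightarrow> 'i set"
  have d_le: "d S \<le> m" for S
    using card_mono[of "{..<m}" "{j. j < m \<and> k \<notin> S j}"] by (auto simp: d_def)
  define p where "p = (\<Sum>S\<in>T. monom (w S) (d S))"
  have coeff: "coeff p r = (\<Sum>S | S \<in> T \<and> d S = r. w S)" for r
    using finT by (simp add: p_def coeff_sum sum.inter_filter)
  have VK: "V - K = insert k (V - insert k K)" "k \<notin> V - insert k K"
    using insert by auto
  have poly: "poly p t = partial_mix f m V K (x(k := t))" for t
  proof -
    have "poly p t = (\<Sum>S\<in>T. w S * t ^ d S)" by (simp add: p_def poly_sum poly_monom)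
    also have "\<dots> = partial_mix f m V K (x(k := t))"
      unfolding partial_mix_def T_def[symmetric]
    proof (rule sum.cong[OF refl])
      fix S
      have "(\<Prod>i\<in>V - K. (x(k := t)) i ^ card {j. j < m \<and> i \<notin> S j}) =
          t ^ d S * (\<Prod>i\<in>V - insert k K. (x(k := t)) i ^ card {j. j < m \<and> i \<notin> S j})"
        unfolding VK(1) using finV VK(2) by (subst prod.insert) (auto simp: d_def)
      also have "(\<Prod>i\<in>V - insert k K. (x(k := t)) i ^ card {j. j < m \<and> i \<notin> S j}) =
          (\<Prod>i\<in>V - insert k K. x i ^ card {j. j < m \<and> i \<notin> S j})"
        by (intro prod.cong) auto
      finally show "w S * t ^ d S = (\<Prod>j<m. f j (S j)) *
          (\<Prod>i\<in>V - K. (x(k := t)) i ^ card {j. j < m \<and> i \<notin> S j})"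
        by (simp add: w_def ac_simps)
    qed
    finally show ?thesis .
  qed
  have roots: "poly p t \<noteq> 0" if "Im t \<ge> 0" for t
    unfolding poly using insert.prems that by (intro insert.IH) auto
  \<comment> \<open>Exponent \<open>m\<close> means that no set of the tuple contains
    \<open>k\<close>, so the tuple lives on \<open>V - {k}\<close>.\<close>
  have "coeff p m = partial_mix f m (V - {k}) K x"
  proof -
    have d_eq: "d S = m \<longleftrightarrow> (\<forall>j<m. k \<notin> S j)" for S :: "nat \<Rightarrow> 'i set"
    proof
      assume "d S = m"
      then have "{j. j < m \<and> k \<notin> S j} = {..<m}"
        by (intro card_subset_eq) (auto simp: d_def)
      then show "\<forall>j<m. k \<notin> S j" by auto
    next
      assume "\<forall>j<m. k \<notin> S j"
      then have "{j. j < m \<and> k \<notin> S j} = {..<m}" by auto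
      then show "d S = m" by (simp add: d_def)
    qed
    have PiE_eq: "S \<in> {..<m} \<rightarrow>\<^sub>E Pow V \<and> (\<forall>j<m. k \<notin> S j) \<longleftrightarrow>
        S \<in> {..<m} \<rightarrow>\<^sub>E Pow (V - {k})" for S
      by (auto simp: PiE_iff)
    have "{S. S \<in> T \<and> d S = m} =
        {S. S \<in> {..<m} \<rightarrow>\<^sub>E Pow (V - {k}) \<and> (\<forall>k\<in>K. \<exists>!j. j < m \<and> k \<in> S j)}"
      unfolding T_def d_eq mem_Collect_eq PiE_eq[symmetric] by (rule Collect_cong) argo
    moreover have "V - insert k K = V - {k} - K" by auto
    ultimately show ?thesis by (simp add: coeff partial_mix_def w_def)
  qed
  also have "\<dots> \<noteq> 0"
    using insert by (intro insert.IH) auto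
  finally have top: "coeff p m \<noteq> 0" .
  have "degree p \<le> m"
    unfolding p_def using d_le by (intro degree_sum_le finT) (meson degree_monom_le le_trans)
  with top have "degree p = Suc (m - 1)"
    using m le_degree[of p m] by auto
  then have "Im (coeff p (m - 1) / coeff p (Suc (m - 1))) > 0"
    by (rule Im_top_coeff_ratio_pos) (rule roots)
  then have "coeff p (m - 1) \<noteq> 0" by auto
  \<comment> \<open>Exponent \<open>m - 1\<close> means that exactly one set contains
    \<open>k\<close>, which is the extra condition imposed by \<open>insert k K\<close>.\<close>
  moreover have "coeff p (m - 1) = partial_mix f m V (insert k K) x"
  proof -
    have "{S. S \<in> T \<and> d S = m - 1} =
        {S. S \<in> {..<m} \<rightarrow>\<^sub>E Pow V \<and> (\<forall>k\<in>insert k K. \<exists>!j. j < m \<and> k \<in> S j)}"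
      unfolding T_def d_def card_complement_eq_pred[OF m] by auto
    then show ?thesis by (simp add: coeff partial_mix_def w_def)
  qed
  ultimately show ?case by simp
qed

text \<open>Ordered partitions are the tuples in which each element lies in exactly one set. With
  \<open>K = U\<close> no powers of \<open>x\<close> remain, so any point may be chosen.\<close>

lemma set_mix_eq_partial_mix: "set_mix f m U = partial_mix f m U U x"
proof -
  have iff: "(disjoint_family_on S {..<m} \<and> (\<Union>i<m. S i) = U) \<longleftrightarrow> (\<forall>k\<in>U. \<exists>!j. j < m \<and> k \<in> S j)"
    if "S \<in> {..<m} \<rightarrow>\<^sub>E Pow U" for S
  proof
    assume S: "disjoint_family_on S {..<m} \<and> (\<Union>i<m. S i) = U"
    show "\<forall>k\<in>U. \<exists>!j. j < m \<and> k \<in> S j"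
    proof
      fix k assume "k \<in> U"
      then obtain j where "j < m" "k \<in> S j" using S by auto
      moreover have "j' = j" if "j' < m" "k \<in> S j'" for j'
        using S calculation that unfolding disjoint_family_on_def by blast
      ultimately show "\<exists>!j. j < m \<and> k \<in> S j" by blast
    qed
  next
    assume unique: "\<forall>k\<in>U. \<exists>!j. j < m \<and> k \<in> S j"
    have sub: "S j \<subseteq> U" if "j < m" for j using \<open>S \<in> _\<close> that by auto
    have "S i \<inter> S j = {}" if "i < m" "j < m" "i \<noteq> j" for i j
      using unique sub[of i] that by blast
    moreover have "(\<Union>i<m. S i) = U"
      using unique sub by blast
    ultimately show "disjoint_family_on S {..<m} \<and> (\<Union>i<m. S i) = U"
      by (simp add: disjoint_family_on_def)
  qed
  then show ?thesis
    unfolding set_mix_def partial_mix_def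
    by (intro sum.cong Collect_cong conj_cong[OF refl iff]) auto
qed

lemma set_mix_nonzero:
  fixes f :: "nat \<Rightarrow> 'i set \<Rightarrow> complex"
  assumes "m \<ge> 1" "finite U"
    and "\<And>j V x. j < m \<Longrightarrow> V \<subseteq> U \<Longrightarrow> (\<And>i. i \<in> V \<Longrightarrow> Im (x i) \<ge> 0) \<Longrightarrow>
      (\<Sum>S\<in>Pow V. f j S * (\<Prod>i\<in>V - S. x i)) \<noteq> 0"
  shows "set_mix f m U \<noteq> 0"
  unfolding set_mix_eq_partial_mix[of _ _ _ "\<lambda>_. 0"]
  using assms by (intro partial_mix_nonzero) auto

section \<open>Mixed determinants as sums over ordered partitions, and their evaluation\<close>

lemma mixed_det_eq_set_mix:
  assumes "\<And>i. i < m \<Longrightarrow> A i \<in> carrier_mat n n"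
  shows "mixed_det n m A = set_mix (\<lambda>i. minor (\<lambda>a b. A i $$ (a, b))) m {..<n}"
  unfolding mixed_det_def set_mix_def
  by (intro sum.cong prod.cong refl det_principal_submatrix[where n = n]) (auto simp: assms)

lemma mixed_det_principal_submatrix:
  assumes A: "\<And>i. i < m \<Longrightarrow> A i \<in> carrier_mat n n" and W: "W \<subseteq> {..<n}"
  shows "mixed_det (card W) m (\<lambda>i. principal_submatrix (A i) W) =
    set_mix (\<lambda>i. minor (\<lambda>a b. A i $$ (a, b))) m W"
proof -
  have "finite W" using W finite_subset by blast
  then have pick: "bij_betw (pick W) {..<card W} W" by (rule pick_bij_betw)
  have "mixed_det (card W) m (\<lambda>i. principal_submatrix (A i) W) =
      set_mix (\<lambda>i. minor (\<lambda>a b. principal_submatrix (A i) W $$ (a, b))) m {..<card W}"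
    by (rule mixed_det_eq_set_mix) (simp add: principal_submatrix_eq_mat[OF A W])
  also have "\<dots> = set_mix (\<lambda>i T. minor (\<lambda>a b. A i $$ (a, b)) (pick W ` T)) m {..<card W}"
  proof (rule set_mix_cong)
    fix i T assume i: "i < m" and T: "T \<subseteq> {..<card W}"
    have "minor (\<lambda>a b. principal_submatrix (A i) W $$ (a, b)) T =
        minor (\<lambda>a b. A i $$ (pick W a, pick W b)) T"
      using T by (intro minor_cong) (auto simp: principal_submatrix_eq_mat[OF A[OF i] W] subset_iff)
    also have "\<dots> = minor (\<lambda>a b. A i $$ (a, b)) (pick W ` T)"
      using inj_on_subset[OF bij_betw_imp_inj_on[OF pick] T] finite_subset[OF T]
      by (intro minor_reindex[symmetric]) simp_all
    finally show "minor (\<lambda>a b. principal_submatrix (A i) W $$ (a, b)) T =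
        minor (\<lambda>a b. A i $$ (a, b)) (pick W ` T)" .
  qed
  also have "\<dots> = set_mix (\<lambda>i. minor (\<lambda>a b. A i $$ (a, b))) m (pick W ` {..<card W})"
    by (rule set_mix_reindex[symmetric]) (use pick in \<open>auto simp: bij_betw_def\<close>)
  finally show ?thesis using pick by (simp add: bij_betw_def)
qed

lemma meval_set_mix: "meval (set_mix f m U) z = set_mix (\<lambda>i S. meval (f i S) z) m U"
  for f :: "nat \<Rightarrow> 'i set \<Rightarrow> 'a::comm_ring_1 mpoly"
  by (simp add: set_mix_def meval_sum meval_prod)

lemma meval_minor: "meval (minor M S) z = minor (\<lambda>a b. meval (M a b) z) S"
  for M :: "'i \<Rightarrow> 'i \<Rightarrow> 'a::comm_ring_1 mpoly"
  by (simp add: minor_def meval_sum meval_prod meval_mult meval_of_int)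

lemma polys_set_mix:
  "(\<And>i S. i < m \<Longrightarrow> S \<subseteq> U \<Longrightarrow> f i S \<in> polys l) \<Longrightarrow> set_mix f m U \<in> polys l"
  for f :: "nat \<Rightarrow> 'i set \<Rightarrow> 'a::comm_ring_1 mpoly"
  unfolding set_mix_def by (intro polys_sum polys_prod) auto

lemma polys_minor:
  "(\<And>a b. a \<in> S \<Longrightarrow> b \<in> S \<Longrightarrow> M a b \<in> polys l) \<Longrightarrow> minor M S \<in> polys l"
  for M :: "'i \<Rightarrow> 'i \<Rightarrow> 'a::comm_ring_1 mpoly"
  unfolding minor_def
  by (intro polys_sum polys_mult polys_of_int polys_prod) (auto simp: permutes_in_image)

section \<open>Hermitian pencils\<close>

lemma hermitian_mat_entry:
  assumes "A \<in> carrier_mat n n" "hermitian_mat A" "a < n" "b < n"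
  shows "A $$ (b, a) = cnj (A $$ (a, b))"
proof -
  have "A $$ (b, a) = mat_adjoint A $$ (b, a)"
    using assms(2) by (simp add: hermitian_mat_def)
  also have "\<dots> = cnj (A $$ (a, b))"
    using assms by (simp add: mat_adjoint_def mat_of_rows_index)
  finally show ?thesis .
qed

lemma Im_hermitian_form:
  assumes "\<And>a b. a \<in> U \<Longrightarrow> b \<in> U \<Longrightarrow> M b a = cnj (M a b)"
  shows "Im (\<Sum>a\<in>U. \<Sum>b\<in>U. cnj (v a) * M a b * v b) = 0"
proof -
  let ?q = "\<Sum>a\<in>U. \<Sum>b\<in>U. cnj (v a) * M a b * v b"
  have "cnj ?q = (\<Sum>a\<in>U. \<Sum>b\<in>U. cnj (v b) * cnj (M a b) * v a)"
    by (simp add: ac_simps)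
  also have "\<dots> = (\<Sum>a\<in>U. \<Sum>b\<in>U. cnj (v b) * M b a * v a)"
  proof (intro sum.cong refl)
    fix a b assume "a \<in> U" "b \<in> U"
    then show "cnj (v b) * cnj (M a b) * v a = cnj (v b) * M b a * v a"
      by (simp only: assms[of a b])
  qed
  also have "\<dots> = ?q" by (rule sum.swap)
  finally show ?thesis
    unfolding Reals_cnj_iff[symmetric] by (simp only: complex_is_Real_iff)
qed

lemma Re_psd_form:
  assumes "A \<in> carrier_mat n n" "psd_mat A"
  shows "Re (\<Sum>a<n. \<Sum>b<n. cnj (v a) * A $$ (a, b) * v b) \<ge> 0"
proof -
  define x where "x = Matrix.vec n v"
  have "Re ((A *\<^sub>v x) \<bullet>c x) \<ge> 0"
    using assms unfolding psd_mat_def by (auto simp: x_def)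
  also have "(A *\<^sub>v x) \<bullet>c x = (\<Sum>a<n. (\<Sum>b<n. A $$ (a, b) * v b) * cnj (v a))"
    using assms(1) by (simp add: x_def Matrix.scalar_prod_def atLeast0LessThan)
  also have "\<dots> = (\<Sum>a<n. \<Sum>b<n. cnj (v a) * A $$ (a, b) * v b)"
    by (simp add: sum_distrib_right sum_distrib_left ac_simps)
  finally show ?thesis .
qed

text \<open>A convergent sequence together with its limit is compact, so \<open>g\<close> is
  uniformly continuous on the product of this set with \<open>K\<close>. This supplies the uniform
  limits for Hurwitz' theorem.\<close>

lemma uniform_limit_of_jointly_continuous:
  fixes g :: "'a::heine_borel \<Rightarrow> 'b::metric_space \<Rightarrow> 'c::metric_space"
  assumes g: "continuous_on UNIV (\<lambda>(e, t). g e t)" and K: "compact K" and X: "X \<longlonglongrightarrow> e"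
  shows "uniform_limit K (\<lambda>n. g (X n)) (g e) sequentially"
proof (rule uniform_limitI)
  fix \<epsilon> :: real assume "\<epsilon> > 0"
  let ?E = "insert e (range X)"
  have "compact ?E" using X by (rule compact_sequence_with_limit)
  then have "uniformly_continuous_on (?E \<times> K) (\<lambda>(e, t). g e t)"
    using K by (intro compact_uniformly_continuous compact_Times continuous_on_subset[OF g] subset_UNIV)
  then obtain \<delta> where "\<delta> > 0" and \<delta>: "\<And>p p'. p \<in> ?E \<times> K \<Longrightarrow> p' \<in> ?E \<times> K \<Longrightarrow> dist p' p < \<delta> \<Longrightarrow>
      dist ((\<lambda>(e, t). g e t) p') ((\<lambda>(e, t). g e t) p) < \<epsilon>"
    using \<open>\<epsilon> > 0\<close> by (rule uniformly_continuous_onE) blast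
  have "\<forall>\<^sub>F n in sequentially. dist (X n) e < \<delta>"
    using X \<open>\<delta> > 0\<close> by (rule tendstoD)
  then show "\<forall>\<^sub>F n in sequentially. \<forall>t\<in>K. dist (g (X n) t) (g e t) < \<epsilon>"
  proof eventually_elim
    case (elim n)
    show ?case
    proof
      fix t assume "t \<in> K"
      then show "dist (g (X n) t) (g e t) < \<epsilon>"
        using \<delta>[of "(e, t)" "(X n, t)"] elim by (simp add: dist_Pair_Pair)
    qed
  qed
qed

section \<open>Stability of the mixed determinant of a tuple of pencils\<close>

definition pencil_value ::
  "nat \<Rightarrow> (nat \<Rightarrow> complex mat) \<Rightarrow> complex mat \<Rightarrow> (nat \<Rightarrow> complex) \<Rightarrow> nat \<Rightarrow> nat \<Rightarrow> complex" where
  "pencil_value l A B z a b = (\<Sum>k<l. A k $$ (a, b) * z k) + B $$ (a, b)"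

lemma meval_linear_pencil:
  "a < n \<Longrightarrow> b < n \<Longrightarrow> meval (linear_pencil n l A B $$ (a, b)) z = pencil_value l A B z a b"
  by (simp add: linear_pencil_def pencil_value_def meval_add meval_sum meval_mult)

lemma linear_pencil_carrier: "linear_pencil n l A B \<in> carrier_mat n n"
  by (simp add: linear_pencil_def)

text \<open>A locale because the theorem uses it twice: for the given tuple and for the tuple
  extended by one matrix and one variable.\<close>

locale psd_pencils =
  fixes l m n :: nat
    and A :: "nat \<Rightarrow> nat \<Rightarrow> complex mat"
    and B :: "nat \<Rightarrow> complex mat"
  assumes A_psd: "\<And>j k. j < m \<Longrightarrow> k < l \<Longrightarrow> A j k \<in> carrier_mat n n \<and> psd_mat (A j k)"
    and B_herm: "\<And>j. j < m \<Longrightarrow> B j \<in> carrier_mat n n \<and> hermitian_mat (B j)"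
begin

text \<open>The parameter \<open>e\<close> adds \<open>e\<close> times the identity to every pencil.
  With \<open>Im e > 0\<close> the imaginary parts become definite; \<open>e = 0\<close> recovers
  \<open>eta\<close>.\<close>

definition eta_at :: "(nat \<Rightarrow> complex) \<Rightarrow> complex \<Rightarrow> complex" where
  "eta_at z e = set_mix (\<lambda>i. minor (\<lambda>a b. pencil_value l (A i) (B i) z a b + of_bool (a = b) * e)) m {..<n}"

definition eta :: "complex mpoly" where
  "eta = mixed_det n m (\<lambda>i. linear_pencil n l (A i) (B i))"

lemma eta_eq: "eta = set_mix (\<lambda>i. minor (\<lambda>a b. linear_pencil n l (A i) (B i) $$ (a, b))) m {..<n}"
  unfolding eta_def by (rule mixed_det_eq_set_mix) (rule linear_pencil_carrier)

lemma meval_eta: "meval eta z = eta_at z 0"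
  unfolding eta_eq eta_at_def meval_set_mix meval_minor
  by (intro set_mix_cong minor_cong) (auto simp: meval_linear_pencil subset_iff)

lemma eta_polys: "eta \<in> polys l"
  unfolding eta_eq
  by (intro polys_set_mix polys_minor)
    (auto simp: linear_pencil_def subset_iff intro!: polys_add polys_sum polys_mult polys_mconst polys_mvar)

lemma A_hermitian: "j < m \<Longrightarrow> k < l \<Longrightarrow> a < n \<Longrightarrow> b < n \<Longrightarrow> A j k $$ (b, a) = cnj (A j k $$ (a, b))"
  using A_psd[of j k] by (metis hermitian_mat_entry psd_mat_def)

lemma B_hermitian: "j < m \<Longrightarrow> a < n \<Longrightarrow> b < n \<Longrightarrow> B j $$ (b, a) = cnj (B j $$ (a, b))"
  using B_herm[of j] by (metis hermitian_mat_entry)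

text \<open>Conjugating the value at the conjugate point transposes every pencil, because all
  coefficient matrices are Hermitian, and minors are invariant under transposition.\<close>

lemma eta_real: "mcoeff eta e \<in> \<real>"
proof (rule mcoeff_real_if_conjugation_invariant)
  fix z
  have "cnj (eta_at (\<lambda>i. cnj (z i)) 0) =
      set_mix (\<lambda>i. minor (\<lambda>a b. cnj (pencil_value l (A i) (B i) (\<lambda>i. cnj (z i)) a b))) m {..<n}"
    by (simp add: eta_at_def set_mix_def minor_def)
  also have "\<dots> = set_mix (\<lambda>i. minor (\<lambda>a b. pencil_value l (A i) (B i) z b a)) m {..<n}"
  proof (intro set_mix_cong minor_cong)
    fix i S a b assume i: "i < m" and "S \<subseteq> {..<n}" "a \<in> S" "b \<in> S"
    then have ab: "a < n" "b < n" by auto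
    have "cnj (A i k $$ (a, b)) = A i k $$ (b, a)" if "k < l" for k
      using A_hermitian[OF i that ab] by simp
    moreover have "cnj (B i $$ (a, b)) = B i $$ (b, a)"
      using B_hermitian[OF i ab] by simp
    ultimately show "cnj (pencil_value l (A i) (B i) (\<lambda>i. cnj (z i)) a b) =
        pencil_value l (A i) (B i) z b a"
      by (simp add: pencil_value_def)
  qed
  also have "\<dots> = eta_at z 0"
  proof -
    have "minor (\<lambda>a b. pencil_value l (A i) (B i) z b a) = minor (pencil_value l (A i) (B i) z)" for i
      by (rule ext) (rule minor_transpose)
    then show ?thesis by (simp add: eta_at_def)
  qed
  finally show "cnj (meval eta (\<lambda>i. cnj (z i))) = meval eta z"
    by (simp add: meval_eta)
qed

text \<open>Each \<open>A j k\<close> contributes \<open>Im (z k)\<close> times a nonnegative real,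
  \<open>B j\<close> contributes nothing, and the shift contributes \<open>Im e\<close> times the
  squared norm of \<open>v\<close>, which is positive.\<close>

lemma Im_pencil_form_pos:
  assumes "j < m" and z: "\<And>k. k < l \<Longrightarrow> Im (z k) \<ge> 0" and "Im e > 0" and v: "\<exists>i<n. v i \<noteq> 0"
  shows "Im (\<Sum>a<n. \<Sum>b<n. cnj (v a) *
    (pencil_value l (A j) (B j) z a b + of_bool (a = b) * e) * v b) > 0"
proof -
  define q where "q M = (\<Sum>a<n. \<Sum>b<n. cnj (v a) * M a b * v b)" for M
  have norm_sum: "complex_of_real (\<Sum>a<n. (cmod (v a))\<^sup>2) = (\<Sum>a<n. v a * cnj (v a))"
    by (simp only: of_real_sum complex_norm_square)
  have "(\<Sum>a<n. \<Sum>b<n. cnj (v a) *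
      (pencil_value l (A j) (B j) z a b + of_bool (a = b) * e) * v b) =
      (\<Sum>a<n. \<Sum>b<n. \<Sum>k<l. z k * (cnj (v a) * A j k $$ (a, b) * v b)) + q (\<lambda>a b. B j $$ (a, b))
      + (\<Sum>a<n. \<Sum>b<n. if a = b then e * (v a * cnj (v a)) else 0)"
    unfolding q_def pencil_value_def sum.distrib[symmetric]
  proof (intro sum.cong refl)
    fix a b
    show "cnj (v a) * ((\<Sum>k<l. A j k $$ (a, b) * z k) + B j $$ (a, b) + of_bool (a = b) * e) * v b =
        (\<Sum>k<l. z k * (cnj (v a) * A j k $$ (a, b) * v b)) + cnj (v a) * B j $$ (a, b) * v b +
        (if a = b then e * (v a * cnj (v a)) else 0)"
      by (simp add: distrib_left distrib_right sum_distrib_left sum_distrib_right mult.assoc mult.commute mult.left_commute)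
  qed
  also have "(\<Sum>a<n. \<Sum>b<n. \<Sum>k<l. z k * (cnj (v a) * A j k $$ (a, b) * v b)) =
      (\<Sum>k<l. z k * q (\<lambda>a b. A j k $$ (a, b)))"
    unfolding q_def sum_distrib_left
    by (subst (2) sum.swap, rule sum.cong[OF refl]) (rule sum.swap)
  also have "(\<Sum>a<n. \<Sum>b<n. if a = b then e * (v a * cnj (v a)) else 0) =
      e * of_real (\<Sum>a<n. (cmod (v a))\<^sup>2)"
    unfolding norm_sum by (simp add: sum_distrib_left)
  finally have form: "(\<Sum>a<n. \<Sum>b<n. cnj (v a) *
      (pencil_value l (A j) (B j) z a b + of_bool (a = b) * e) * v b) =
      (\<Sum>k<l. z k * q (\<lambda>a b. A j k $$ (a, b))) + q (\<lambda>a b. B j $$ (a, b))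
      + e * of_real (\<Sum>a<n. (cmod (v a))\<^sup>2)" .
  have "Im (\<Sum>a<n. \<Sum>b<n. cnj (v a) *
      (pencil_value l (A j) (B j) z a b + of_bool (a = b) * e) * v b) =
      (\<Sum>k<l. Im (z k * q (\<lambda>a b. A j k $$ (a, b)))) + Im (q (\<lambda>a b. B j $$ (a, b)))
      + Im e * (\<Sum>a<n. (cmod (v a))\<^sup>2)"
  proof -
    have "Im (e * of_real r) = Im e * r" for r by simp
    then show ?thesis unfolding form by (simp only: plus_complex.sel Im_sum)
  qed
  moreover have "Im (z k * q (\<lambda>a b. A j k $$ (a, b))) \<ge> 0" if "k < l" for k
  proof -
    have "Im (q (\<lambda>a b. A j k $$ (a, b))) = 0"
      unfolding q_def by (rule Im_hermitian_form) (rule A_hermitian[OF \<open>j < m\<close> that], simp_all)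
    moreover have "Re (q (\<lambda>a b. A j k $$ (a, b))) \<ge> 0"
      unfolding q_def using A_psd[OF \<open>j < m\<close> that] by (intro Re_psd_form) auto
    ultimately show ?thesis using z[OF that] by simp
  qed
  then have "(\<Sum>k<l. Im (z k * q (\<lambda>a b. A j k $$ (a, b)))) \<ge> 0"
    by (intro sum_nonneg) auto
  moreover have "Im (q (\<lambda>a b. B j $$ (a, b))) = 0"
    unfolding q_def by (rule Im_hermitian_form) (rule B_hermitian[OF \<open>j < m\<close>], simp_all)
  moreover have "(\<Sum>a<n. (cmod (v a))\<^sup>2) > 0"
  proof -
    obtain i where "i < n" "v i \<noteq> 0" using v by blast
    then show ?thesis by (intro sum_pos2[of _ i]) auto
  qed
  then have "Im e * (\<Sum>a<n. (cmod (v a))\<^sup>2) > 0"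
    using \<open>Im e > 0\<close> by (rule mult_pos_pos[rotated])
  ultimately show ?thesis by linarith
qed

text \<open>The sums required to be nonzero by \<open>set_mix_nonzero\<close> are, by
  \<open>minor_add_diag\<close>, minors of the shifted pencil plus a diagonal, to which the
  definiteness argument applies.\<close>

lemma eta_at_nonzero:
  assumes "m \<ge> 1" and z: "\<And>k. k < l \<Longrightarrow> Im (z k) \<ge> 0" and e: "Im e > 0"
  shows "eta_at z e \<noteq> 0"
  unfolding eta_at_def
proof (rule set_mix_nonzero)
  fix j V and x :: "nat \<Rightarrow> complex"
  assume j: "j < m" and V: "V \<subseteq> {..<n}" and x: "\<And>i. i \<in> V \<Longrightarrow> Im (x i) \<ge> 0"
  let ?C = "\<lambda>a b. pencil_value l (A j) (B j) z a b + of_bool (a = b) * e"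
  have "finite V" using V finite_subset by blast
  then have "(\<Sum>S\<in>Pow V. minor ?C S * (\<Prod>i\<in>V - S. x i)) =
      minor (\<lambda>a b. ?C a b + (if a = b then x a else 0)) V"
    by (rule minor_add_diag[symmetric])
  also have "\<dots> \<noteq> 0"
  proof (rule minor_add_diag_nonzero[OF _ V])
    show "Im (\<Sum>a<n. \<Sum>b<n. cnj (v a) * ?C a b * v b) > 0" if "\<exists>i\<in>{..<n}. v i \<noteq> 0" for v
      using that by (intro Im_pencil_form_pos j z e) auto
  qed (use x in auto)
  finally show "(\<Sum>S\<in>Pow V. minor ?C S * (\<Prod>i\<in>V - S. x i)) \<noteq> 0" .
qed (use assms in auto)

text \<open>Semidefinite coefficients are handled by adding small multiples of \<open>\<i>\<close> to the diagonals and
  passing to the limit with Hurwitz' theorem, along a line through a point where the polynomial is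
  nonzero.\<close>

lemma eta_stable:
  assumes "m \<ge> 1" "eta \<noteq> 0"
  shows "stable l eta"
  unfolding stable_def
proof (intro conjI allI impI)
  show "eta \<in> polys l" by (rule eta_polys)
  fix z assume z: "\<forall>k<l. Im (z k) > 0"
  obtain w where w: "meval eta w \<noteq> 0"
    using assms(2) mpoly_eq_zero_if_meval_zero by blast
  define g where "g e t = eta_at (\<lambda>k. z k + t * (w k - z k)) e" for e t
  have cont: "continuous_on UNIV (\<lambda>(e, t). g e t)"
    unfolding g_def eta_at_def set_mix_def minor_def pencil_value_def case_prod_beta
    by (intro continuous_intros)
  have hol: "g e holomorphic_on S" for e S
    unfolding g_def eta_at_def set_mix_def minor_def pencil_value_def
    by (intro holomorphic_intros)
  define D where "D = (\<Inter>k<l. {t. Im (z k + t * (w k - z k)) > 0})"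
  have "open D"
    unfolding D_def by (intro open_INT finite_lessThan ballI open_Collect_less continuous_intros)
  moreover have "0 \<in> D" using z by (simp add: D_def)
  ultimately obtain r where r: "r > 0" "ball 0 r \<subseteq> D"
    using open_contains_ball by blast
  have "g 0 0 \<noteq> 0"
  proof (cases "g 0 constant_on ball 0 r")
    \<comment> \<open>Hurwitz' theorem needs a nonconstant limit. If \<open>g 0\<close> is constant
      near 0, analytic continuation carries the constant to \<open>t = 1\<close>, where the value is
      nonzero by the choice of \<open>w\<close>.\<close>
    case True
    then have const: "g 0 t = g 0 0" if "t \<in> ball 0 r" for t
      using that r(1) by (auto simp: constant_on_def)
    have "g 0 1 = g 0 0"
    proof (rule analytic_continuation_open[of "ball 0 r" UNIV "g 0" "\<lambda>_. g 0 0"])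
      show "g 0 t = g 0 0" if "t \<in> ball 0 r" for t using that by (rule const)
    qed (use r(1) hol in auto)
    then show ?thesis using w by (simp add: g_def meval_eta)
  next
    case False
    define X where "X n = \<i> * of_real (inverse (real (Suc n)))" for n
    have "X \<longlonglongrightarrow> \<i> * of_real 0"
      unfolding X_def by (intro tendsto_intros LIMSEQ_inverse_real_of_nat)
    then have X: "X \<longlonglongrightarrow> 0" by simp
    show ?thesis
    proof (rule Hurwitz_no_zeros[of "ball 0 r" "\<lambda>n. g (X n)" "g 0" 0])
      show "uniform_limit K (\<lambda>n. g (X n)) (g 0) sequentially" if "compact K" for K
        using cont that X by (rule uniform_limit_of_jointly_continuous)
      show "g (X n) t \<noteq> 0" if "t \<in> ball 0 r" for n t
        unfolding g_def
      proof (rule eta_at_nonzero[OF assms(1)])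
        have "t \<in> D" using that r(2) by blast
        then show "Im (z k + t * (w k - z k)) \<ge> 0" if "k < l" for k
          using that by (auto simp: D_def less_imp_le)
        show "Im (X n) > 0" by (simp add: X_def)
      qed
    qed (use False hol r(1) in auto)
  qed
  then show "meval eta z \<noteq> 0" by (simp add: g_def meval_eta)
qed

lemma eta_in_real_stable_polys: "m \<ge> 1 \<Longrightarrow> eta \<in> real_stable_polys l \<union> {0}"
  using eta_stable eta_real by (auto simp: real_stable_polys_def)

end

section \<open>Appending a matrix with a single diagonal entry\<close>

lemma minor_unit_entry:
  fixes v :: "'a::comm_ring_1"
  assumes "finite T"
  shows "minor (\<lambda>a b. if a = j \<and> b = j then v else 0) T = (if T = {} then 1 else if T = {j} then v else 0)"
proof -
  consider "T = {}" | "T = {j}" | i where "i \<in> T" "i \<noteq> j" by blast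
  then show ?thesis
  proof cases
    case 3
    then have "(\<Prod>i\<in>T. if i = j \<and> p i = j then v else 0) = 0" for p :: "'b \<Rightarrow> 'b"
      using assms by (intro prod_zero bexI[of _ i]) auto
    then show ?thesis using 3 by (auto simp: minor_def)
  next
    case 2
    then have "{p. p permutes T} = {id}" by (auto simp: permutes_sing)
    then show ?thesis using 2 by (simp add: minor_def)
  next
    case 1
    then have "{p. p permutes T} = {id}" by (auto simp: permutes_empty)
    then show ?thesis using 1 by (simp add: minor_def)
  qed
qed

text \<open>Any set containing an index other than \<open>j\<close> has a zero row, hence minor 0.
  When the last set is split off, only the empty set, with minor 1, and \<open>{j}\<close>, with
  minor \<open>v\<close>, survive.\<close>

lemma set_mix_Suc_unit_entry:
  fixes f :: "nat \<Rightarrow> 'i set \<Rightarrow> 'a::comm_ring_1"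
  assumes "finite U" "j \<in> U"
    and f: "\<And>T. T \<subseteq> U \<Longrightarrow> f m T = minor (\<lambda>a b. if a = j \<and> b = j then v else 0) T"
  shows "set_mix f (Suc m) U = set_mix f m U + v * set_mix f m (U - {j})"
proof -
  have fm: "f m T = (if T = {} then 1 else if T = {j} then v else 0)" if "T \<subseteq> U" for T
  proof -
    have "finite T" using that assms(1) by (rule finite_subset)
    then show ?thesis unfolding f[OF that] by (rule minor_unit_entry)
  qed
  have "set_mix f (Suc m) U = (\<Sum>T\<in>Pow U. f m T * set_mix f m (U - T))"
    by (rule set_mix_Suc[OF assms(1)])
  also have "\<dots> = (\<Sum>T\<in>{{}, {j}}. f m T * set_mix f m (U - T))"
    by (rule sum.mono_neutral_right) (use assms(1,2) fm in auto)
  also have "\<dots> = set_mix f m U + v * set_mix f m (U - {j})"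
    using assms(2) by (simp add: fm)
  finally show ?thesis .
qed

lemma hermitian_matI:
  assumes "A \<in> carrier_mat n n" "\<And>a b. a < n \<Longrightarrow> b < n \<Longrightarrow> A $$ (b, a) = cnj (A $$ (a, b))"
  shows "hermitian_mat A"
  unfolding hermitian_mat_def
proof (rule eq_matI)
  fix a b assume "a < dim_row A" "b < dim_col A"
  then have ab: "a < n" "b < n" using assms(1) by auto
  then have "mat_adjoint A $$ (a, b) = cnj (A $$ (b, a))"
    using assms(1) by (simp add: mat_adjoint_def mat_of_rows_index)
  then show "mat_adjoint A $$ (a, b) = A $$ (a, b)"
    using assms(2)[OF ab(2,1)] by simp
qed (use assms(1) in \<open>auto simp: mat_adjoint_def\<close>)

text \<open>The form is \<open>c\<close> times the squared modulus of coordinate \<open>j\<close>.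
  The order on complex numbers makes \<open>c\<close> a nonnegative real; \<open>c = 1\<close> gives
  the appended matrix and \<open>c = 0\<close> the zero matrix.\<close>

lemma psd_mat_unit_entry:
  "psd_mat (Matrix.mat n n (\<lambda>(a, b). if a = j \<and> b = j then c else 0))"
  if "c \<ge> 0" for c :: complex
  unfolding psd_mat_def
proof (intro conjI ballI)
  let ?E = "Matrix.mat n n (\<lambda>(a, b). if a = j \<and> b = j then c else 0)"
  have c: "Im c = 0" "Re c \<ge> 0" using that by (simp_all add: less_eq_complex_def)
  show "hermitian_mat ?E"
    by (rule hermitian_matI[of _ n]) (use c in \<open>auto simp: complex_eq_iff\<close>)
  fix x :: "complex Matrix.vec" assume "x \<in> carrier_vec (dim_row ?E)"
  then have x: "dim_vec x = n" by auto
  have "(?E *\<^sub>v x) \<bullet>c x = (\<Sum>a<n. (\<Sum>b<n. if a = j \<and> b = j then c * x $ b else 0) * cnj (x $ a))"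
    using x by (auto simp: Matrix.scalar_prod_def atLeast0LessThan intro!: sum.cong)
  also have "\<dots> = (\<Sum>a<n. if a = j then c * (x $ j * cnj (x $ j)) else 0)"
  proof (rule sum.cong[OF refl])
    fix a assume "a \<in> {..<n}"
    then show "(\<Sum>b<n. if a = j \<and> b = j then c * x $ b else 0) * cnj (x $ a) =
        (if a = j then c * (x $ j * cnj (x $ j)) else 0)"
      by (cases "a = j") (simp_all add: mult.assoc)
  qed
  also have "\<dots> = (if j < n then c * of_real ((cmod (x $ j))\<^sup>2) else 0)"
    unfolding complex_norm_square by simp
  also have "Re \<dots> \<ge> 0"
    using c by (simp del: of_real_power)
  finally show "Re ((?E *\<^sub>v x) \<bullet>c x) \<ge> 0" .
qed

theorem theorem2p6:
  fixes l m n :: nat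
    and A :: "nat \<Rightarrow> nat \<Rightarrow> complex mat"
    and B :: "nat \<Rightarrow> complex mat"
    and L :: "nat \<Rightarrow> complex mpoly mat"
  assumes "l \<ge> 1" and "m \<ge> 1" and "n \<ge> 1"
    and A_psd: "\<And>j k. j < m \<Longrightarrow> k < l \<Longrightarrow> A j k \<in> carrier_mat n n \<and> psd_mat (A j k)"
    and B_herm: "\<And>j. j < m \<Longrightarrow> B j \<in> carrier_mat n n \<and> hermitian_mat (B j)"
    and L_eq: "\<And>j. j < m \<Longrightarrow> L j = linear_pencil n l (A j) (B j)"
  shows "mixed_det n m L \<in> real_stable_polys l \<union> {0} \<and>
    (\<forall>j<n. mixed_det n m L
         + mvar l * mixed_det (n - 1) m (\<lambda>i. principal_submatrix (L i) ({..<n} - {j}))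
       \<in> real_stable_polys (l + 1) \<union> {0})"
proof (intro conjI allI impI)
  interpret psd_pencils l m n A B by unfold_locales (use A_psd B_herm in auto)
  have L_carrier: "L i \<in> carrier_mat n n" if "i < m" for i
    using L_eq[OF that] by (simp add: linear_pencil_carrier)
  have L_mix: "mixed_det n m L = set_mix (\<lambda>i. minor (\<lambda>a b. L i $$ (a, b))) m {..<n}"
    by (rule mixed_det_eq_set_mix) (rule L_carrier)
  also have "\<dots> = eta"
    unfolding eta_eq by (intro set_mix_cong) (simp add: L_eq)
  finally show "mixed_det n m L \<in> real_stable_polys l \<union> {0}"
    using eta_in_real_stable_polys[OF \<open>m \<ge> 1\<close>] by simp
  fix j assume "j < n"
  define E where "E = Matrix.mat n n (\<lambda>(a, b). if a = j \<and> b = j then 1 else 0 :: complex)"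
  \<comment> \<open>The old pencils do not involve the new variable, number \<open>l\<close>, and
    the new pencil, number \<open>m\<close>, is that variable times \<open>E\<close>. Zero matrices
    in the other places keep all coefficients semidefinite.\<close>
  define A' where "A' i k = (if i < m \<and> k < l then A i k else if i = m \<and> k = l then E else 0\<^sub>m n n)" for i k
  define B' where "B' i = (if i < m then B i else 0\<^sub>m n n)" for i
  define L' where "L' i = linear_pencil n (l + 1) (A' i) (B' i)" for i
  have zero_herm: "hermitian_mat (0\<^sub>m n n)"
    by (rule hermitian_matI[of _ n]) auto
  have zero_psd: "psd_mat (0\<^sub>m n n)"
    using psd_mat_unit_entry[of 0 n j] by (simp add: zero_mat_def case_prod_beta')
  have E_carrier: "E \<in> carrier_mat n n" by (simp add: E_def)
  have E_psd: "psd_mat E"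
    unfolding E_def by (rule psd_mat_unit_entry) (simp add: less_eq_complex_def)
  interpret ext: psd_pencils "l + 1" "m + 1" n A' B'
    by unfold_locales
      (use A_psd B_herm zero_herm zero_psd E_carrier E_psd in \<open>auto simp: A'_def B'_def\<close>)
  have L'_eq: "L' i $$ (a, b) = L i $$ (a, b)" if "i < m" "a < n" "b < n" for i a b
    using that by (simp add: L'_def L_eq linear_pencil_def A'_def B'_def mconst_def)
  have L'_last: "L' m $$ (a, b) = (if a = j \<and> b = j then mvar l else 0)" if "a < n" "b < n" for a b
    using that by (simp add: L'_def linear_pencil_def A'_def B'_def E_def mconst_def)
  have L'_mix: "set_mix (\<lambda>i. minor (\<lambda>a b. L' i $$ (a, b))) m W =
      set_mix (\<lambda>i. minor (\<lambda>a b. L i $$ (a, b))) m W" if "W \<subseteq> {..<n}" for W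
    using that by (intro set_mix_cong minor_cong) (auto intro!: L'_eq)
  have "ext.eta = set_mix (\<lambda>i. minor (\<lambda>a b. L' i $$ (a, b))) (Suc m) {..<n}"
    using ext.eta_eq by (simp add: L'_def)
  also have "\<dots> = set_mix (\<lambda>i. minor (\<lambda>a b. L' i $$ (a, b))) m {..<n} +
      mvar l * set_mix (\<lambda>i. minor (\<lambda>a b. L' i $$ (a, b))) m ({..<n} - {j})"
    using \<open>j < n\<close> by (intro set_mix_Suc_unit_entry minor_cong) (auto simp: L'_last subset_iff)
  also have "\<dots> = mixed_det n m L +
      mvar l * mixed_det (n - 1) m (\<lambda>i. principal_submatrix (L i) ({..<n} - {j}))"
    \<comment> \<open>The set \<open>{..<n} - {j}\<close> has \<open>n - 1\<close> elements because
      \<open>j < n\<close>, which matches the size of the principal submatrices.\<close>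
    using mixed_det_principal_submatrix[of m L n "{..<n} - {j}"] L_carrier \<open>j < n\<close>
    by (simp add: L'_mix L_mix)
  finally show "mixed_det n m L
         + mvar l * mixed_det (n - 1) m (\<lambda>i. principal_submatrix (L i) ({..<n} - {j}))
       \<in> real_stable_polys (l + 1) \<union> {0}"
    using ext.eta_in_real_stable_polys by simp
qed

end
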